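(* Let $a,b,p,Z,w$ be real parameters with $p>1$. (i) For $a>0$, $b>0$ and $\frac{Z^2}{4}<-w$, the functions $\phi_{w,Z}$ are equilibrium solutions of the equation $$u_t-u_{xx}=Z\delta(x)u+wu+au^p+bu^{2p-1},\qquad t,x\in\mathbb{R}.$$ Moreover, the mapping $Z\in(-2\sqrt{-w},2\sqrt{-w})\mapsto\phi_{w,Z}$ is a real analytic function. (ii) For $a>0$, $b<0$ and $\frac{Z^2}{4}<-w<-\frac{pa^2}{(p+1)^2b}$, the functions $\phi_{w,Z}$ are equilibrium solutions of the same equation. Moreover, the mapping $Z\in(-2\sqrt{-w},2\sqrt{-w})\mapsto\phi_{w,Z}$ is a real analytic function.
   Context: Put $\alpha=\frac{a}{p+1}$, $\beta=\frac{b}{p}$, and let $R:(-\infty,\infty)\to(-1,1)$ be the diffeomorphism $$R(s)=\frac{\sqrt{\alpha^2-\beta w}\,\sinh((p-1)\sqrt{-w}\,s)}{\alpha+\sqrt{\alpha^2-\beta w}\,\cosh((p-1)\sqrt{-w}\,s)}.$$ Define $$\phi_{w,Z}(x)=\left[\frac{\alpha}{-w}+\frac{\sqrt{\alpha^2-\beta w}}{-w}\cosh\left((p-1)\sqrt{-w}\left(|x|+R^{-1}\left(\frac{Z}{2\sqrt{-w}}\right)\right)\right)\right]^{\frac{-1}{p-1}},\quad x\in\mathbb{R}.$$ $\delta$ is the Dirac distribution at $0$. The operator $\partial_{xx}+Z\delta(x)$ acts as $g\mapsto g''$ on $\mathbb{R}\setminus\{0\}$ with domain $\{g\in H^1(\mathbb{R})\cap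 H^2(\mathbb{R}\setminus\{0\}) : g'(0+)-g'(0-)=-Zg(0)\}$. An equilibrium solution is a function $\phi$ in this domain satisfying $$(\partial_{xx}+Z\delta(x))\phi+w\phi+a\phi^p+b\phi^{2p-1}=0.$$ *)

theory Defs
  imports "HOL-Analysis.Analysis"
begin

section \<open>Sobolev spaces on open subsets of the real line\<close>

definition test_function :: "real set \<Rightarrow> (real \<Rightarrow> real) \<Rightarrow> bool" where
  "test_function S \<psi> \<longleftrightarrow>
     (\<forall>n. (deriv ^^ n) \<psi> differentiable_on UNIV) \<and>
     compact (closure {x. \<psi> x \<noteq> 0}) \<and> closure {x. \<psi> x \<noteq> 0} \<subseteq> S"

definition L2 :: "real set \<Rightarrow> (real \<Rightarrow> real) set" where
  "L2 S = {f. set_borel_measurable lebesgue S f \<and> set_integrable lebesgue S (\<lambda>x. (f x)\<^sup>2)}"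

text \<open>Only used for \<open>u\<close> and \<open>v\<close> in \<open>L2 S\<close>, so that both integrals exist.\<close>

definition weak_deriv :: "real set \<Rightarrow> (real \<Rightarrow> real) \<Rightarrow> (real \<Rightarrow> real) \<Rightarrow> bool" where
  "weak_deriv S u v \<longleftrightarrow>
     (\<forall>\<psi>. test_function S \<psi> \<longrightarrow>
        (LINT x:S|lebesgue. u x * deriv \<psi> x) = - (LINT x:S|lebesgue. v x * \<psi> x))"

primrec sobolev :: "nat \<Rightarrow> real set \<Rightarrow> (real \<Rightarrow> real) set" where
  "sobolev 0 S = L2 S"
| "sobolev (Suc k) S = {u \<in> L2 S. \<exists>v \<in> sobolev k S. weak_deriv S u v}"

text \<open>
  For \<open>u\<close> in \<open>sobolev 1 UNIV\<close> the weak derivative is unique up to null sets, hence the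
  infimum is taken over a set with exactly one element, the usual norm of \<open>u\<close>.
\<close>

definition H1_norm :: "(real \<Rightarrow> real) \<Rightarrow> real" where
  "H1_norm u = Inf {sqrt ((LINT x|lebesgue. (u x)\<^sup>2) + (LINT x|lebesgue. (v x)\<^sup>2)) | v.
                      v \<in> L2 UNIV \<and> weak_deriv UNIV u v}"

text \<open>
  Real analyticity of a map from an open set \<open>I\<close> of parameters into the Banach space
  \<open>sobolev 1 UNIV\<close>: around each point the map is the sum of a power series with coefficients in
  that space, convergent in its norm.
\<close>

definition real_analytic_H1_on :: "(real \<Rightarrow> real \<Rightarrow> real) \<Rightarrow> real set \<Rightarrow> bool" where
  "real_analytic_H1_on F I \<longleftrightarrow>
     (\<forall>z \<in> I. F z \<in> sobolev 1 UNIV) \<and>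
     (\<forall>z\<^sub>0 \<in> I. \<exists>r > 0. \<exists>c :: nat \<Rightarrow> real \<Rightarrow> real.
        (\<forall>n. c n \<in> sobolev 1 UNIV) \<and>
        (\<forall>z \<in> I. \<bar>z - z\<^sub>0\<bar> < r \<longrightarrow>
           (\<lambda>N. H1_norm (\<lambda>x. F z x - (\<Sum>n<N. (z - z\<^sub>0) ^ n * c n x))) \<longlonglongrightarrow> 0))"


section \<open>The Laplacian with a point interaction at the origin\<close>

text \<open>
  Elements of the domain are represented by their continuous representative. Such a function is
  continuously differentiable away from \<open>0\<close>, so that \<open>g'(0+)\<close> and \<open>g'(0-)\<close> are
  one-sided limits of the classical derivative.
\<close>

definition delta_domain :: "real \<Rightarrow> (real \<Rightarrow> real) set" where
  "delta_domain Z =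
     {g. g \<in> sobolev 1 UNIV \<and> g \<in> sobolev 2 (UNIV - {0}) \<and> continuous_on UNIV g \<and>
         (\<exists>d\<^sub>r d\<^sub>l. (deriv g \<longlongrightarrow> d\<^sub>r) (at_right 0) \<and> (deriv g \<longlongrightarrow> d\<^sub>l) (at_left 0) \<and>
                  d\<^sub>r - d\<^sub>l = - Z * g 0)}"

text \<open>
  The operator as a relation: \<open>h\<close> represents the image of \<open>g\<close>, that is, its second weak
  derivative away from the origin. It is determined up to null sets.
\<close>

definition delta_operator :: "real \<Rightarrow> (real \<Rightarrow> real) \<Rightarrow> (real \<Rightarrow> real) \<Rightarrow> bool" where
  "delta_operator Z g h \<longleftrightarrow>
     g \<in> delta_domain Z \<and> h \<in> L2 (UNIV - {0}) \<and>
     (\<exists>v \<in> L2 (UNIV - {0}). weak_deriv (UNIV - {0}) g v \<and> weak_deriv (UNIV - {0}) v h)"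

text \<open>
  The equation is an identity in the space of square integrable functions, hence holds almost
  everywhere. For real \<open>p\<close> the powers have their intended meaning for nonnegative \<open>\<phi>\<close>.
\<close>

definition equilibrium ::
  "real \<Rightarrow> real \<Rightarrow> real \<Rightarrow> real \<Rightarrow> real \<Rightarrow> (real \<Rightarrow> real) \<Rightarrow> bool" where
  "equilibrium a b p w Z \<phi> \<longleftrightarrow>
     (\<exists>h. delta_operator Z \<phi> h \<and>
          (AE x in lebesgue.
             h x + w * \<phi> x + a * \<phi> x powr p + b * \<phi> x powr (2 * p - 1) = 0))"


section \<open>The explicit profiles\<close>

definition R_fun :: "real \<Rightarrow> real \<Rightarrow> real \<Rightarrow> real \<Rightarrow> real \<Rightarrow> real" where
  "R_fun a b p w s =
     (let \<alpha> = a / (p + 1); \<beta> = b / p in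
        sqrt (\<alpha>\<^sup>2 - \<beta> * w) * sinh ((p - 1) * sqrt (- w) * s) /
        (\<alpha> + sqrt (\<alpha>\<^sup>2 - \<beta> * w) * cosh ((p - 1) * sqrt (- w) * s)))"

text \<open>
  In the parameter ranges of interest \<open>R_fun a b p w\<close> is a diffeomorphism from the real line onto
  the open interval from \<open>-1\<close> to \<open>1\<close>, and \<open>inv\<close> is applied to points of that interval only.
\<close>

definition profile :: "real \<Rightarrow> real \<Rightarrow> real \<Rightarrow> real \<Rightarrow> real \<Rightarrow> real \<Rightarrow> real" where
  "profile a b p w Z x =
     (let \<alpha> = a / (p + 1); \<beta> = b / p in
        (\<alpha> / (- w) + sqrt (\<alpha>\<^sup>2 - \<beta> * w) / (- w) *
           cosh ((p - 1) * sqrt (- w) * (\<bar>x\<bar> + inv (R_fun a b p w) (Z / (2 * sqrt (- w))))))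
        powr (- 1 / (p - 1)))"

end

theory Submission
  imports Defs "HOL-Complex_Analysis.Cauchy_Integral_Formula"
begin

text \<open>
  Write \<open>k = sqrt (- w)\<close>, \<open>c = (p - 1) * k\<close> and \<open>y r = A + B * cosh (c * (r + s))\<close>. The profile is
  \<open>g \<bar>x\<bar>\<close> with \<open>g = y powr (- 1 / (p - 1))\<close>, and three facts about \<open>g\<close> give the first
  half of the theorem.
  Its logarithmic derivative is \<open>- k * R (r + s)\<close>, so that the jump of the derivative of
  \<open>g \<bar>x\<bar>\<close> at the origin is \<open>- 2 * k * R s * g 0\<close>, which is \<open>- Z * g 0\<close> exactly when
  \<open>R s = Z / (2 * k)\<close>: this is what the choice of the shift \<open>s\<close> achieves. A computation with
  \<open>cosh\<^sup>2 - sinh\<^sup>2 = 1\<close> gives \<open>g'' = g * (- w - a / y - b / y\<^sup>2)\<close>, and since \<open>g powr p = g / y\<close> and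
  \<open>g powr (2 * p - 1) = g / y\<^sup>2\<close> this is the differential equation away from the origin
  (\<open>profile_ode_coefficient\<close>). Finally \<open>g\<close> and its derivatives decay like \<open>exp (- k * r)\<close>, so that all
  functions involved are square integrable, and classical derivatives away from the origin are weak
  derivatives by integration by parts (\<open>weak_deriv_of_classical\<close>, \<open>even_delta_operator\<close>).

  For the dependence on \<open>Z\<close>, the equation \<open>R s = \<zeta>\<close> is quadratic in \<open>exp (c * s)\<close>. Its positive root is an
  explicit algebraic function of \<open>\<zeta>\<close>, which shows that \<open>R\<close> attains every value in the open interval from
  \<open>-1\<close> to \<open>1\<close> (\<open>inv_R\<close>), and which extends holomorphically to complex \<open>\<zeta>\<close> near each such value, with
  positive real part (\<open>U_near_real\<close>). Hence the profile extends to a family that is holomorphic in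
  the strength \<open>z\<close> of the interaction and, together with its derivative in \<open>r\<close>, bounded by
  \<open>M * exp (- k * r)\<close> uniformly for \<open>z\<close> in a closed disc of radius \<open>\<rho>\<close>. The Taylor coefficients in \<open>z\<close>
  are integrals over the bounding circle. These integrals may be differentiated in \<open>r\<close>, and they are
  at most \<open>M * exp (- k * r) / \<rho> ^ n\<close>; so the coefficients lie in the Sobolev space and the
  Taylor remainders tend to zero there geometrically (\<open>H1_power_series_of_holomorphic_family\<close>).
\<close>

section \<open>Square integrable functions and weak derivatives\<close>

lemma L2_UNIV_iff:
  "f \<in> L2 UNIV \<longleftrightarrow> f \<in> borel_measurable lebesgue \<and> integrable lebesgue (\<lambda>x. (f x)\<^sup>2)"
  by (simp add: L2_def set_borel_measurable_def set_integrable_def)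

lemma L2_subset:
  assumes "f \<in> L2 UNIV" "S \<in> sets lebesgue"
  shows "f \<in> L2 S"
  using assms unfolding L2_UNIV_iff
  using integrable_mult_indicator[OF assms(2), of "\<lambda>x. (f x)\<^sup>2"]
  by (auto simp: L2_def set_borel_measurable_def set_integrable_def)

lemma L2_mult_integrable:
  assumes "f \<in> L2 UNIV" "g \<in> L2 UNIV"
  shows "integrable lebesgue (\<lambda>x. f x * g x)"
proof (rule Bochner_Integration.integrable_bound)
  show "integrable lebesgue (\<lambda>x. (f x)\<^sup>2 + (g x)\<^sup>2)"
    using assms unfolding L2_UNIV_iff by auto
  show "(\<lambda>x. f x * g x) \<in> borel_measurable lebesgue"
    using assms unfolding L2_UNIV_iff by auto
  have "\<bar>f x * g x\<bar> \<le> (f x)\<^sup>2 + (g x)\<^sup>2" for x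
    using sum_squares_bound[of "\<bar>f x\<bar>" "\<bar>g x\<bar>"]
      mult_nonneg_nonneg[of "\<bar>f x\<bar>" "\<bar>g x\<bar>"]
    unfolding abs_mult power2_abs by linarith
  then show "AE x in lebesgue. norm (f x * g x) \<le> norm ((f x)\<^sup>2 + (g x)\<^sup>2)"
    by auto
qed

lemma borel_measurable_continuous_off_zero:
  fixes f :: "real \<Rightarrow> real"
  assumes "continuous_on (UNIV - {0}) f"
  shows "f \<in> borel_measurable lebesgue"
proof -
  have "(\<lambda>x. if x \<in> UNIV - {0} then f x else 0) \<in> borel_measurable borel"
    by (rule borel_measurable_continuous_on_if) (use assms in auto)
  then have "f \<in> borel_measurable borel"
    by (rule measurable_discrete_difference[of _ _ _ "{0}"]) auto
  then show ?thesis by (simp add: measurable_completion)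
qed

text \<open>
  The weight \<open>exp (- k * \<bar>x\<bar>)\<close> will dominate the profiles, their derivatives and their Taylor
  coefficients; its integrability over the line is reduced, by symmetry, to that of an exponential over a half-line.
\<close>

lemma integrable_exp_abs:
  fixes k :: real
  assumes "k > 0"
  shows "integrable lebesgue (\<lambda>x. exp (- k * \<bar>x\<bar>))"
proof -
  have "set_integrable lebesgue {0..} (\<lambda>x::real. exp (- k * x))"
    by (rule nonnegative_absolutely_integrable_1)
       (use integrable_on_exp_minus_to_infinity[OF assms, of 0] in auto)
  then have "integrable lborel (\<lambda>x. indicator {0..} x *\<^sub>R exp (- k * \<bar>x\<bar>))"
    unfolding set_integrable_def
    by (subst integrable_completion[symmetric])
       (auto simp: indicator_def elim!: Bochner_Integration.integrable_cong[THEN iffD1, rotated -1])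
  then have "integrable lborel (\<lambda>x. exp (- k * \<bar>x\<bar>))"
    by (rule integrable.intros[OF has_bochner_integral_even_function, OF has_bochner_integral_integrable])
       simp
  then show ?thesis by (simp add: integrable_completion)
qed

text \<open>
  Continuity is asked for away from the origin only, because the derivative of an even function may jump there.
\<close>

definition exp_decaying :: "real \<Rightarrow> real \<Rightarrow> (real \<Rightarrow> real) \<Rightarrow> bool" where
  "exp_decaying k M f \<longleftrightarrow>
     continuous_on (UNIV - {0}) f \<and> (\<forall>x. \<bar>f x\<bar> \<le> M * exp (- k * \<bar>x\<bar>))"

lemma exp_decaying_L2:
  assumes "k > 0" "exp_decaying k M f"
  shows "f \<in> L2 UNIV"
    and "(LINT x|lebesgue. (f x)\<^sup>2) \<le> M\<^sup>2 * (LINT x|lebesgue. exp (- (2 * k) * \<bar>x\<bar>))"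
proof -
  have meas: "f \<in> borel_measurable lebesgue"
    using assms borel_measurable_continuous_off_zero by (auto simp: exp_decaying_def)
  have int: "integrable lebesgue (\<lambda>x. M\<^sup>2 * exp (- (2 * k) * \<bar>x\<bar>))"
    by (rule integrable_mult_right[OF integrable_exp_abs]) (use assms in auto)
  have bd: "(f x)\<^sup>2 \<le> M\<^sup>2 * exp (- (2 * k) * \<bar>x\<bar>)" for x
  proof -
    have "(f x)\<^sup>2 = \<bar>f x\<bar>\<^sup>2" by simp
    also have "\<dots> \<le> (M * exp (- k * \<bar>x\<bar>))\<^sup>2"
      using assms by (intro power_mono) (auto simp: exp_decaying_def)
    also have "\<dots> = M\<^sup>2 * exp (- (2 * k) * \<bar>x\<bar>)"
      by (simp add: power_mult_distrib exp_double[symmetric] mult.assoc)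
    finally show ?thesis .
  qed
  have sq: "integrable lebesgue (\<lambda>x. (f x)\<^sup>2)"
    by (rule Bochner_Integration.integrable_bound[OF int]) (use meas bd in auto)
  then show "f \<in> L2 UNIV" using meas by (simp add: L2_UNIV_iff)
  have "(LINT x|lebesgue. (f x)\<^sup>2) \<le> (LINT x|lebesgue. M\<^sup>2 * exp (- (2 * k) * \<bar>x\<bar>))"
    by (rule integral_mono[OF sq int]) (rule bd)
  then show "(LINT x|lebesgue. (f x)\<^sup>2) \<le> M\<^sup>2 * (LINT x|lebesgue. exp (- (2 * k) * \<bar>x\<bar>))"
    by simp
qed

lemma test_functionD:
  assumes "test_function S \<psi>"
  shows "continuous_on UNIV \<psi>" "continuous_on UNIV (deriv \<psi>)"
    and "(\<psi> has_real_derivative deriv \<psi> x) (at x)"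
proof -
  have d: "(deriv ^^ n) \<psi> differentiable_on UNIV" for n
    using assms by (simp add: test_function_def)
  show "continuous_on UNIV \<psi>"
    using d[of 0] differentiable_imp_continuous_on by auto
  show "continuous_on UNIV (deriv \<psi>)"
    using d[of 1] differentiable_imp_continuous_on by auto
  show "(\<psi> has_real_derivative deriv \<psi> x) (at x)"
    using d[of 0] by (metis DERIV_deriv_iff_real_differentiable UNIV_I differentiable_on_def funpow_0)
qed

lemma test_function_off_support:
  assumes "x \<notin> closure {y. \<psi> y \<noteq> 0}"
  shows "\<forall>\<^sub>F y in nhds x. \<psi> y = 0" "\<psi> x = 0" "deriv \<psi> x = (0::real)"
proof -
  have "open (- closure {y. \<psi> y \<noteq> 0})" "x \<in> - closure {y. \<psi> y \<noteq> 0}" using assms by auto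
  moreover have "\<psi> y = 0" if "y \<in> - closure {y. \<psi> y \<noteq> 0}" for y
    using that closure_subset[of "{y. \<psi> y \<noteq> 0}"] by auto
  ultimately show ev: "\<forall>\<^sub>F y in nhds x. \<psi> y = 0"
    unfolding eventually_nhds by blast
  then show "\<psi> x = 0" by (rule eventually_nhds_x_imp_x)
  show "deriv \<psi> x = 0"
    using deriv_cong_ev[OF ev refl] by simp
qed

lemma test_function_support:
  assumes "test_function S \<psi>"
  obtains L where "L > 0" "closure {x. \<psi> x \<noteq> 0} \<subseteq> {-L<..<L}"
proof -
  have "bounded (closure {x. \<psi> x \<noteq> 0})"
    using assms by (simp add: test_function_def compact_imp_bounded)
  then obtain B where B: "\<And>x. x \<in> closure {x. \<psi> x \<noteq> 0} \<Longrightarrow> \<bar>x\<bar> \<le> B"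
    by (auto simp: bounded_iff)
  show ?thesis
    by (rule that[of "\<bar>B\<bar> + 1"]) (use B in force)+
qed

lemma L2_continuous_compact_support:
  fixes f :: "real \<Rightarrow> real"
  assumes "continuous_on UNIV f" "\<And>x. x \<notin> {-L..L} \<Longrightarrow> f x = 0"
  shows "f \<in> L2 UNIV"
proof -
  have "set_integrable lebesgue {-L..L} (\<lambda>x. (f x)\<^sup>2)"
    by (rule absolutely_integrable_continuous_real)
       (intro continuous_intros continuous_on_subset[OF assms(1)], auto)
  moreover have "(\<lambda>x. indicator {-L..L} x *\<^sub>R (f x)\<^sup>2) = (\<lambda>x. (f x)\<^sup>2)"
    using assms(2) by (auto simp: fun_eq_iff indicator_def)
  ultimately have "integrable lebesgue (\<lambda>x. (f x)\<^sup>2)"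
    by (simp add: set_integrable_def)
  moreover have "f \<in> borel_measurable lebesgue"
    by (rule borel_measurable_continuous_off_zero) (rule continuous_on_subset[OF assms(1)], auto)
  ultimately show ?thesis by (simp add: L2_UNIV_iff)
qed

text \<open>
  Integration by parts: for a test function \<open>\<psi>\<close> the product \<open>u * \<psi>\<close> is continuous, is
  differentiable except possibly at the origin and has compact support, so its derivative integrates to zero. At the
  origin continuity has one of two reasons: either the origin belongs to \<open>S\<close> and \<open>u\<close> is
  continuous there, or it does not and \<open>\<psi>\<close> vanishes near it. This covers functions with a corner on the
  whole line as well as derivatives with a jump on the punctured line.
\<close>

lemma weak_deriv_of_classical:
  fixes u v :: "real \<Rightarrow> real"
  assumes S: "UNIV - {0} \<subseteq> S"
    and u: "u \<in> L2 UNIV" and v: "v \<in> L2 UNIV"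
    and deriv: "\<And>x. x \<noteq> 0 \<Longrightarrow> (u has_real_derivative v x) (at x)"
    and cont0: "0 \<in> S \<Longrightarrow> isCont u 0"
  shows "weak_deriv S u v"
  unfolding weak_deriv_def
proof (intro allI impI)
  fix \<psi> assume \<psi>: "test_function S \<psi>"
  let ?K = "closure {x. \<psi> x \<noteq> 0}"
  obtain L where L: "L > 0" "?K \<subseteq> {-L<..<L}"
    using test_function_support[OF \<psi>] .
  have off: "\<psi> x = 0" "deriv \<psi> x = 0" if "x \<notin> {-L<..<L}" for x
    using test_function_off_support(2,3)[of x \<psi>] subsetD[OF L(2), of x] that by auto
  have "\<psi> \<in> L2 UNIV" "deriv \<psi> \<in> L2 UNIV"
    by (rule L2_continuous_compact_support[of _ L]; use test_functionD[OF \<psi>] off in auto)+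
  then have int: "integrable lebesgue (\<lambda>x. u x * deriv \<psi> x)" "integrable lebesgue (\<lambda>x. v x * \<psi> x)"
    using u v by (auto intro: L2_mult_integrable)
  have cont_u: "isCont u x" if "x \<in> S" for x
    using cont0 deriv DERIV_isCont that by (cases "x = 0") auto
  have "isCont (\<lambda>x. u x * \<psi> x) x" for x
  proof (cases "x \<in> S")
    case True
    then show ?thesis
      using cont_u test_functionD(1)[OF \<psi>]
      by (intro continuous_intros) (auto simp: continuous_on_eq_continuous_at)
  next
    case False
    then have "x \<notin> ?K" using \<psi> by (auto simp: test_function_def)
    then have "\<forall>\<^sub>F y in nhds x. u y * \<psi> y = 0"
      using eventually_mono[OF test_function_off_support(1)] by simp
    then show ?thesis by (subst isCont_cong[of _ "\<lambda>_. 0"]) auto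
  qed
  then have "continuous_on {-L..L} (\<lambda>x. u x * \<psi> x)"
    by (intro continuous_at_imp_continuous_on) auto
  moreover have "((\<lambda>x. u x * \<psi> x) has_vector_derivative (u x * deriv \<psi> x + v x * \<psi> x)) (at x)"
    if "x \<in> {-L<..<L} - {0}" for x
    unfolding has_real_derivative_iff_has_vector_derivative[symmetric]
    by (rule derivative_eq_intros deriv test_functionD(3)[OF \<psi>] | use that in auto)+
  ultimately have "((\<lambda>x. u x * deriv \<psi> x + v x * \<psi> x) has_integral (u L * \<psi> L - u (-L) * \<psi> (-L))) {-L..L}"
    by (intro fundamental_theorem_of_calculus_interior_strong[of "{0}"]) (use L in auto)
  then have "((\<lambda>x. u x * deriv \<psi> x + v x * \<psi> x) has_integral 0) {-L..L}"
    by (simp add: off)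
  then have "((\<lambda>x. u x * deriv \<psi> x + v x * \<psi> x) has_integral 0) UNIV"
    by (rule has_integral_on_superset) (auto simp: off)
  moreover have "((\<lambda>x. u x * deriv \<psi> x + v x * \<psi> x) has_integral
      (LINT x|lebesgue. u x * deriv \<psi> x + v x * \<psi> x)) UNIV"
    by (rule has_integral_integral_lebesgue) (use int in auto)
  ultimately have "(LINT x|lebesgue. u x * deriv \<psi> x + v x * \<psi> x) = 0"
    using has_integral_unique by blast
  then have "(LINT x|lebesgue. u x * deriv \<psi> x) = - (LINT x|lebesgue. v x * \<psi> x)"
    using int by simp
  moreover have "(LINT x:S|lebesgue. f x) = (LINT x|lebesgue. f x)" for f :: "real \<Rightarrow> real"
    unfolding set_lebesgue_integral_def
    by (rule integral_discrete_difference[of "{0}"]) (use S in \<open>auto simp: indicator_def\<close>)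
  ultimately show "(LINT x:S|lebesgue. u x * deriv \<psi> x) = - (LINT x:S|lebesgue. v x * \<psi> x)"
    by simp
qed

lemma has_real_derivative_abs:
  fixes x :: real
  assumes "x \<noteq> 0"
  shows "(abs has_real_derivative sgn x) (at x)"
proof (cases "x > 0")
  case True
  then show ?thesis
    using has_field_derivative_transform_within_open[of "\<lambda>x. x" 1 x "{0<..}" abs]
    by auto
next
  case False
  with assms show ?thesis
    using has_field_derivative_transform_within_open[of uminus "-1" x "{..<0}" abs]
      DERIV_minus[OF DERIV_ident, of x UNIV]
    by auto
qed

text \<open>
  The norm of \<open>exp (- k * \<bar>x\<bar>)\<close> in the space of square integrable functions, times \<open>sqrt
  2\<close> to account for a function and its derivative.
\<close>

definition decay_const :: "real \<Rightarrow> real" where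
  "decay_const k = sqrt (2 * (LINT x|lebesgue. exp (- (2 * k) * \<bar>x\<bar>)))"

text \<open>
  An even function may have a corner at the origin without leaving the Sobolev space, its weak derivative being the odd
  extension of the one-sided derivative. The norm is an infimum over all weak derivatives, so exhibiting one of them
  suffices for an upper bound.
\<close>

lemma even_exp_decaying_H1:
  fixes g g' :: "real \<Rightarrow> real"
  assumes k: "k > 0"
    and contg: "continuous_on {0..} g" and contg': "continuous_on {0<..} g'"
    and deriv: "\<And>r. r > 0 \<Longrightarrow> (g has_real_derivative g' r) (at r)"
    and bd: "\<And>r. r \<ge> 0 \<Longrightarrow> \<bar>g r\<bar> \<le> M * exp (- k * r)"
    and bd': "\<And>r. r > 0 \<Longrightarrow> \<bar>g' r\<bar> \<le> M * exp (- k * r)"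
  shows "(\<lambda>x. g \<bar>x\<bar>) \<in> sobolev 1 UNIV"
    and "0 \<le> H1_norm (\<lambda>x. g \<bar>x\<bar>)" and "H1_norm (\<lambda>x. g \<bar>x\<bar>) \<le> M * decay_const k"
proof -
  let ?u = "\<lambda>x. g \<bar>x\<bar>" and ?v = "\<lambda>x. sgn x * g' \<bar>x\<bar>"
  have M: "M \<ge> 0" using bd[of 0] by auto
  have contu: "continuous_on UNIV ?u"
    by (rule continuous_on_compose2[OF contg]) (auto intro!: continuous_intros)
  have du: "exp_decaying k M ?u"
    using continuous_on_subset[OF contu] bd by (auto simp: exp_decaying_def)
  have "\<bar>?v x\<bar> \<le> M * exp (- k * \<bar>x\<bar>)" for x
    using bd'[of "\<bar>x\<bar>"] M by (cases "x = 0") (auto simp: abs_mult abs_sgn_eq)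
  moreover have "continuous_on (UNIV - {0}) ?v"
    by (intro continuous_intros continuous_on_compose2[OF contg']) auto
  ultimately have dv: "exp_decaying k M ?v" by (auto simp: exp_decaying_def)
  note uL2 = exp_decaying_L2[OF k du] and vL2 = exp_decaying_L2[OF k dv]
  have "(?u has_real_derivative ?v x) (at x)" if "x \<noteq> 0" for x
  proof -
    have "(abs has_real_derivative sgn x) (at x)"
      by (rule has_real_derivative_abs) (rule that)
    from DERIV_chain2[OF deriv this] that show ?thesis by (simp add: mult.commute)
  qed
  then have wd: "weak_deriv UNIV ?u ?v"
    using contu uL2(1) vL2(1)
    by (intro weak_deriv_of_classical) (auto simp: continuous_on_eq_continuous_at)
  show "?u \<in> sobolev 1 UNIV" using wd uL2 vL2 by auto
  let ?N = "\<lambda>v. sqrt ((LINT x|lebesgue. (?u x)\<^sup>2) + (LINT x|lebesgue. (v x)\<^sup>2))"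
  let ?A = "{?N v |v. v \<in> L2 UNIV \<and> weak_deriv UNIV ?u v}"
  have mem: "?N ?v \<in> ?A" by (intro CollectI exI[of _ ?v] conjI refl wd vL2(1))
  have nonneg: "0 \<le> t" if "t \<in> ?A" for t using that by auto
  have H: "H1_norm ?u = Inf ?A" by (simp add: H1_norm_def)
  show "0 \<le> H1_norm ?u" unfolding H by (rule cInf_greatest) (use mem nonneg in blast)+
  have "H1_norm ?u \<le> ?N ?v"
    unfolding H by (rule cInf_lower[OF mem bdd_belowI[OF nonneg]])
  also have "\<dots> \<le> sqrt (M\<^sup>2 * (2 * (LINT x|lebesgue. exp (- (2 * k) * \<bar>x\<bar>))))"
    using uL2(2) vL2(2) by (intro real_sqrt_le_mono) simp
  also have "\<dots> = M * decay_const k"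
    using M by (simp add: decay_const_def real_sqrt_mult)
  finally show "H1_norm ?u \<le> M * decay_const k" .
qed

section \<open>Power series in the Sobolev space from holomorphic families\<close>

text \<open>
  Cauchy's integral for the \<open>n\<close>-th Taylor coefficient of \<open>f\<close> at \<open>z\<^sub>0\<close>,
  parametrised by the unit interval. As an integral with a parameter it is accessible to the Leibniz rule, unlike the
  coefficient defined by iterated derivatives.
\<close>

definition circle_coeff :: "complex \<Rightarrow> real \<Rightarrow> nat \<Rightarrow> (complex \<Rightarrow> complex) \<Rightarrow> complex" where
  "circle_coeff z\<^sub>0 \<rho> n f =
     integral {0..1} (\<lambda>t. f (circlepath z\<^sub>0 \<rho> t) / (circlepath z\<^sub>0 \<rho> t - z\<^sub>0) ^ n)"

lemma circlepath_mem_sphere: "\<rho> \<ge> 0 \<Longrightarrow> circlepath z\<^sub>0 \<rho> t \<in> sphere z\<^sub>0 \<rho>"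
  by (simp add: circlepath dist_norm norm_mult)

lemma continuous_on_circlepath: "continuous_on A (circlepath z\<^sub>0 \<rho>)"
  unfolding circlepath_def part_circlepath_def linepath_def by (intro continuous_intros)

lemma circlepath_minus_centre: "norm (circlepath z\<^sub>0 \<rho> t - z\<^sub>0) = \<bar>\<rho>\<bar>"
  by (simp add: circlepath norm_mult)

lemma circle_coeff_eq_deriv:
  assumes "\<rho> > 0" "continuous_on (cball z\<^sub>0 \<rho>) f" "f holomorphic_on ball z\<^sub>0 \<rho>"
  shows "circle_coeff z\<^sub>0 \<rho> n f = (deriv ^^ n) f z\<^sub>0 / fact n"
proof -
  let ?\<gamma> = "circlepath z\<^sub>0 \<rho>"
  have "((\<lambda>u. f u / (u - z\<^sub>0) ^ Suc n) has_contour_integral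
          (2 * pi * \<i>) / fact n * (deriv ^^ n) f z\<^sub>0) ?\<gamma>"
    using assms by (intro Cauchy_has_contour_integral_higher_derivative_circlepath) auto
  then have "((\<lambda>t. f (?\<gamma> t) / (?\<gamma> t - z\<^sub>0) ^ Suc n * (2 * pi * \<i> * \<rho> * exp (2 * of_real pi * \<i> * t)))
      has_integral (2 * pi * \<i>) / fact n * (deriv ^^ n) f z\<^sub>0) {0..1}"
    unfolding has_contour_integral vector_derivative_circlepath .
  moreover have "f (?\<gamma> t) / (?\<gamma> t - z\<^sub>0) ^ Suc n * (2 * pi * \<i> * \<rho> * exp (2 * of_real pi * \<i> * t))
      = (2 * pi * \<i>) * (f (?\<gamma> t) / (?\<gamma> t - z\<^sub>0) ^ n)" for t
  proof -
    have "?\<gamma> t - z\<^sub>0 = \<rho> * exp (2 * of_real pi * \<i> * t)"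
      by (simp add: circlepath)
    moreover from this have "?\<gamma> t - z\<^sub>0 \<noteq> 0" using assms(1) by simp
    ultimately show ?thesis by (simp add: field_simps)
  qed
  ultimately have "((\<lambda>t. (2 * pi * \<i>) * (f (?\<gamma> t) / (?\<gamma> t - z\<^sub>0) ^ n))
      has_integral (2 * pi * \<i>) * ((deriv ^^ n) f z\<^sub>0 / fact n)) {0..1}"
    by simp
  from has_integral_mult_right[OF this, of "1 / (2 * pi * \<i>)"]
  have "((\<lambda>t. f (?\<gamma> t) / (?\<gamma> t - z\<^sub>0) ^ n) has_integral (deriv ^^ n) f z\<^sub>0 / fact n) {0..1}"
    by (simp add: field_simps)
  then show ?thesis unfolding circle_coeff_def by (rule integral_unique)
qed

lemma norm_circle_coeff_le:
  assumes "\<rho> > 0" "continuous_on (cball z\<^sub>0 \<rho>) f" "\<And>z. z \<in> cball z\<^sub>0 \<rho> \<Longrightarrow> norm (f z) \<le> M"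
  shows "norm (circle_coeff z\<^sub>0 \<rho> n f) \<le> M / \<rho> ^ n"
proof -
  let ?\<gamma> = "circlepath z\<^sub>0 \<rho>"
  have mem: "?\<gamma> t \<in> cball z\<^sub>0 \<rho>" for t using circlepath_mem_sphere[of \<rho> z\<^sub>0 t] assms(1) by auto
  have ne: "?\<gamma> t - z\<^sub>0 \<noteq> 0" for t using circlepath_minus_centre[of z\<^sub>0 \<rho> t] assms(1) by auto
  have "norm (integral {0..1} (\<lambda>t. f (?\<gamma> t) / (?\<gamma> t - z\<^sub>0) ^ n)) \<le> M / \<rho> ^ n * (1 - 0)"
  proof (rule integral_bound)
    show "continuous_on {0..1} (\<lambda>t. f (?\<gamma> t) / (?\<gamma> t - z\<^sub>0) ^ n)"
      by (intro continuous_intros continuous_on_compose2[OF assms(2)] continuous_on_circlepath)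
         (use mem ne in auto)
    show "norm (f (?\<gamma> t) / (?\<gamma> t - z\<^sub>0) ^ n) \<le> M / \<rho> ^ n" for t
      using assms(1,3) mem[of t]
      by (simp add: norm_divide norm_power circlepath_minus_centre divide_right_mono)
  qed simp
  then show ?thesis by (simp add: circle_coeff_def)
qed

text \<open>
  By Cauchy's estimate the tail of the Taylor series is dominated by a geometric series. The bound is linear in
  \<open>M\<close>, so that a decay of \<open>f\<close> in a further parameter passes to the remainder.
\<close>

lemma circle_coeff_remainder:
  assumes \<rho>: "\<rho> > 0" and cont: "continuous_on (cball z\<^sub>0 \<rho>) f" and hol: "f holomorphic_on ball z\<^sub>0 \<rho>"
    and M: "\<And>z. z \<in> cball z\<^sub>0 \<rho> \<Longrightarrow> norm (f z) \<le> M"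
    and z: "norm (z - z\<^sub>0) = \<theta> * \<rho>" "\<theta> < 1"
  shows "norm (f z - (\<Sum>n<N. circle_coeff z\<^sub>0 \<rho> n f * (z - z\<^sub>0) ^ n)) \<le> M * (\<theta> ^ N / (1 - \<theta>))"
proof -
  let ?a = "\<lambda>n. circle_coeff z\<^sub>0 \<rho> n f * (z - z\<^sub>0) ^ n"
  have "0 \<le> \<theta> * \<rho>" by (metis z(1) norm_ge_zero)
  then have \<theta>: "\<theta> \<ge> 0" using \<rho> by (simp add: zero_le_mult_iff)
  have "\<theta> * \<rho> < \<rho>" using z(2) \<rho> by simp
  then have "z \<in> ball z\<^sub>0 \<rho>"
    using z by (simp add: dist_norm norm_minus_commute)
  then have "?a sums f z"
    using holomorphic_power_series[OF hol] circle_coeff_eq_deriv[OF \<rho> cont hol] by simp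
  then have tail: "(\<lambda>n. ?a (n + N)) sums (f z - (\<Sum>n<N. ?a n))"
    by (rule sums_split_initial_segment)
  have bd: "norm (?a (n + N)) \<le> M * \<theta> ^ N * \<theta> ^ n" for n
  proof -
    have "norm (?a (n + N)) \<le> M / \<rho> ^ (n + N) * (\<theta> * \<rho>) ^ (n + N)"
      unfolding norm_mult norm_power z(1)
      using norm_circle_coeff_le[OF \<rho> cont M, where n = "n + N"] \<rho> \<theta>
      by (intro mult_right_mono) auto
    also have "\<dots> = M * \<theta> ^ N * \<theta> ^ n"
      using \<rho> by (simp add: power_mult_distrib power_add)
    finally show ?thesis .
  qed
  have geo: "(\<lambda>n. M * \<theta> ^ N * \<theta> ^ n) sums (M * \<theta> ^ N * (1 / (1 - \<theta>)))"
    using \<theta> z(2) by (intro sums_mult geometric_sums) auto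
  have "norm (suminf (\<lambda>n. ?a (n + N))) \<le> (\<Sum>n. M * \<theta> ^ N * \<theta> ^ n)"
    by (rule norm_suminf_le[OF bd sums_summable[OF geo]])
  then show ?thesis
    using sums_unique[OF tail] sums_unique[OF geo] by simp
qed

lemma circle_coeff_continuous_parameter:
  assumes "\<rho> > 0"
    and cont: "continuous_on (cball z\<^sub>0 \<rho> \<times> U) (\<lambda>(z, r). \<psi> z r)"
  shows "continuous_on ((U::real set) \<times> cbox 0 (1::real))
           (\<lambda>(r, t). \<psi> (circlepath z\<^sub>0 \<rho> t) r / (circlepath z\<^sub>0 \<rho> t - z\<^sub>0) ^ n)"
    and "continuous_on U (\<lambda>r. circle_coeff z\<^sub>0 \<rho> n (\<lambda>z. \<psi> z r))"
proof -
  let ?\<gamma> = "circlepath z\<^sub>0 \<rho>"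
  have mem: "?\<gamma> t \<in> cball z\<^sub>0 \<rho>" for t using circlepath_mem_sphere[of \<rho> z\<^sub>0 t] assms(1) by auto
  have ne: "?\<gamma> t - z\<^sub>0 \<noteq> 0" for t using circlepath_minus_centre[of z\<^sub>0 \<rho> t] assms(1) by auto
  have c: "continuous_on A (\<lambda>x. ?\<gamma> (snd x))" for A :: "(real \<times> real) set"
    by (intro continuous_on_compose2[OF continuous_on_circlepath[of UNIV]] continuous_intros) auto
  have "continuous_on (U \<times> cbox 0 1) (\<lambda>x. (\<lambda>(z, r). \<psi> z r) (?\<gamma> (snd x), fst x))"
    by (rule continuous_on_compose2[OF cont]) (use mem in \<open>auto intro!: continuous_intros c\<close>)
  then have "continuous_on (U \<times> cbox 0 1) (\<lambda>x. \<psi> (?\<gamma> (snd x)) (fst x))" by simp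
  then show *: "continuous_on (U \<times> cbox 0 1)
           (\<lambda>(r, t). \<psi> (?\<gamma> t) r / (?\<gamma> t - z\<^sub>0) ^ n)"
    unfolding case_prod_beta using ne by (intro continuous_intros c) auto
  show "continuous_on U (\<lambda>r. circle_coeff z\<^sub>0 \<rho> n (\<lambda>z. \<psi> z r))"
    using integral_continuous_on_param[OF *] by (simp add: circle_coeff_def)
qed

lemma circle_coeff_has_vector_derivative:
  fixes U :: "real set"
  assumes \<rho>: "\<rho> > 0" and U: "convex U" "r \<in> U"
    and cont: "continuous_on (cball z\<^sub>0 \<rho> \<times> U) (\<lambda>(z, r). \<psi> z r)"
    and cont': "continuous_on (cball z\<^sub>0 \<rho> \<times> U) (\<lambda>(z, r). \<psi>' z r)"
    and deriv: "\<And>z r. z \<in> cball z\<^sub>0 \<rho> \<Longrightarrow> r \<in> U \<Longrightarrow>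
                  ((\<lambda>r. \<psi> z r) has_vector_derivative \<psi>' z r) (at r within U)"
  shows "((\<lambda>r. circle_coeff z\<^sub>0 \<rho> n (\<lambda>z. \<psi> z r)) has_vector_derivative
           circle_coeff z\<^sub>0 \<rho> n (\<lambda>z. \<psi>' z r)) (at r within U)"
proof -
  let ?\<gamma> = "circlepath z\<^sub>0 \<rho>"
  have mem: "?\<gamma> t \<in> cball z\<^sub>0 \<rho>" for t using circlepath_mem_sphere[of \<rho> z\<^sub>0 t] \<rho> by auto
  note joint = circle_coeff_continuous_parameter(1)[OF \<rho> cont, of n]
  have "((\<lambda>r. integral (cbox 0 1) (\<lambda>t. \<psi> (?\<gamma> t) r / (?\<gamma> t - z\<^sub>0) ^ n)) has_vector_derivative
          integral (cbox 0 1) (\<lambda>t. \<psi>' (?\<gamma> t) r / (?\<gamma> t - z\<^sub>0) ^ n)) (at r within U)"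
  proof (rule leibniz_rule_vector_derivative[OF _ _ _ U(2,1)])
    show "((\<lambda>r. \<psi> (?\<gamma> t) r / (?\<gamma> t - z\<^sub>0) ^ n) has_vector_derivative \<psi>' (?\<gamma> t) r / (?\<gamma> t - z\<^sub>0) ^ n)
            (at r within U)" if "r \<in> U" for r t
      by (rule has_vector_derivative_divide[OF deriv[OF mem that]])
    show "(\<lambda>t. \<psi> (?\<gamma> t) r / (?\<gamma> t - z\<^sub>0) ^ n) integrable_on cbox 0 1" if "r \<in> U" for r
    proof (rule integrable_continuous)
      have "continuous_on (cbox 0 1)
              (\<lambda>t. (\<lambda>(r, t). \<psi> (?\<gamma> t) r / (?\<gamma> t - z\<^sub>0) ^ n) (r, t))"
        by (rule continuous_on_compose2[OF joint]) (use that in \<open>auto intro!: continuous_intros\<close>)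
      then show "continuous_on (cbox 0 1) (\<lambda>t. \<psi> (?\<gamma> t) r / (?\<gamma> t - z\<^sub>0) ^ n)" by simp
    qed
  qed (rule circle_coeff_continuous_parameter(1)[OF \<rho> cont'])
  then show ?thesis by (simp add: circle_coeff_def)
qed

text \<open>
  The criterion for analyticity. Pointwise the power series is the Taylor series in \<open>z\<close>, and both its
  coefficients and its remainders inherit the factor \<open>exp (- k * r)\<close>. The same holds for the family of
  derivatives, whose coefficients are the derivatives of the coefficients. Hence the pointwise estimates become estimates
  in the Sobolev norm.
\<close>

lemma H1_power_series_of_holomorphic_family:
  fixes \<psi> \<psi>' :: "complex \<Rightarrow> real \<Rightarrow> complex" and F :: "real \<Rightarrow> real \<Rightarrow> real"
  assumes k: "k > 0" and \<rho>: "\<rho> > 0"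
    and hol: "\<And>r. r \<ge> 0 \<Longrightarrow> (\<lambda>z. \<psi> z r) holomorphic_on ball (of_real z\<^sub>0) \<rho>"
    and hol': "\<And>r. r \<ge> 0 \<Longrightarrow> (\<lambda>z. \<psi>' z r) holomorphic_on ball (of_real z\<^sub>0) \<rho>"
    and cont: "continuous_on (cball (of_real z\<^sub>0) \<rho> \<times> {0..}) (\<lambda>(z, r). \<psi> z r)"
    and cont': "continuous_on (cball (of_real z\<^sub>0) \<rho> \<times> {0..}) (\<lambda>(z, r). \<psi>' z r)"
    and deriv: "\<And>z r. z \<in> cball (of_real z\<^sub>0) \<rho> \<Longrightarrow> r \<ge> 0 \<Longrightarrow>
                  ((\<lambda>r. \<psi> z r) has_vector_derivative \<psi>' z r) (at r within {0..})"
    and bd: "\<And>z r. z \<in> cball (of_real z\<^sub>0) \<rho> \<Longrightarrow> r \<ge> 0 \<Longrightarrow> norm (\<psi> z r) \<le> M * exp (- k * r)"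
    and bd': "\<And>z r. z \<in> cball (of_real z\<^sub>0) \<rho> \<Longrightarrow> r \<ge> 0 \<Longrightarrow> norm (\<psi>' z r) \<le> M * exp (- k * r)"
    and F: "\<And>z x. z \<in> I \<Longrightarrow> \<bar>z - z\<^sub>0\<bar> < \<rho> \<Longrightarrow> F z x = Re (\<psi> (of_real z) \<bar>x\<bar>)"
  shows "\<exists>r > 0. \<exists>c :: nat \<Rightarrow> real \<Rightarrow> real.
        (\<forall>n. c n \<in> sobolev 1 UNIV) \<and>
        (\<forall>z \<in> I. \<bar>z - z\<^sub>0\<bar> < r \<longrightarrow>
           (\<lambda>N. H1_norm (\<lambda>x. F z x - (\<Sum>n<N. (z - z\<^sub>0) ^ n * c n x))) \<longlonglongrightarrow> 0)"
proof -
  define C where "C = (\<lambda>n r. circle_coeff (of_real z\<^sub>0) \<rho> n (\<lambda>z. \<psi> z r))"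
  define C' where "C' = (\<lambda>n r. circle_coeff (of_real z\<^sub>0) \<rho> n (\<lambda>z. \<psi>' z r))"
  have Cderiv: "(C n has_vector_derivative C' n r) (at r within {0..})" if "r \<ge> 0" for n r
    unfolding C_def C'_def
    by (rule circle_coeff_has_vector_derivative[OF \<rho> _ _ cont cont' deriv]) (use that in auto)
  have Ccont: "continuous_on {0..} (C n)" "continuous_on {0..} (C' n)" for n
    unfolding C_def C'_def
    using circle_coeff_continuous_parameter(2)[OF \<rho> cont]
      circle_coeff_continuous_parameter(2)[OF \<rho> cont'] by auto
  have slice: "continuous_on (cball (of_real z\<^sub>0) \<rho>) (\<lambda>z. f z r)" "continuous_on {0..} (f z)"
    if f: "continuous_on (cball (of_real z\<^sub>0) \<rho> \<times> {0..}) (\<lambda>(z, r). f z r)"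
      and "r \<ge> 0" "z \<in> cball (of_real z\<^sub>0) \<rho>" for r z and f :: "complex \<Rightarrow> real \<Rightarrow> complex"
  proof -
    have "continuous_on (cball (of_real z\<^sub>0) \<rho>) (\<lambda>z. (\<lambda>(z, r). f z r) (z, r))"
      by (rule continuous_on_compose2[OF f]) (use that in \<open>auto intro!: continuous_intros\<close>)
    then show "continuous_on (cball (of_real z\<^sub>0) \<rho>) (\<lambda>z. f z r)" by simp
    have "continuous_on {0..} (\<lambda>r. (\<lambda>(z, r). f z r) (z, r))"
      by (rule continuous_on_compose2[OF f]) (use that in \<open>auto intro!: continuous_intros\<close>)
    then show "continuous_on {0..} (f z)" by simp
  qed
  have centre: "complex_of_real z\<^sub>0 \<in> cball (of_real z\<^sub>0) \<rho>" using \<rho> by simp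
  note slice_\<psi> = slice(1)[OF cont _ centre] and slice_\<psi>' = slice(1)[OF cont' _ centre]
  have real_deriv: "((\<lambda>r. Re (f r)) has_real_derivative Re f') (at r)"
    if "(f has_vector_derivative f') (at r within {0..})" "r > 0" for f f' and r :: real
  proof -
    have "at r within {0..} = at r" using that(2) by (intro at_within_interior) (simp add: interior_real_atLeast)
    with that(1) show ?thesis
      unfolding has_real_derivative_iff_has_vector_derivative
      using bounded_linear.has_vector_derivative[OF bounded_linear_Re] by auto
  qed
  have "(\<lambda>x. Re (C n \<bar>x\<bar>)) \<in> sobolev 1 UNIV" for n
  proof (rule even_exp_decaying_H1(1)[OF k, where g' = "\<lambda>r. Re (C' n r)" and M = "M / \<rho> ^ n"])
    show "((\<lambda>r. Re (C n r)) has_real_derivative Re (C' n r)) (at r)" if "r > 0" for r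
      by (rule real_deriv[OF Cderiv]) (use that in auto)
    have "norm (C n r) \<le> M * exp (- k * r) / \<rho> ^ n" and C'_bd: "norm (C' n r) \<le> M * exp (- k * r) / \<rho> ^ n"
      if "r \<ge> 0" for r
      unfolding C_def C'_def
      by (rule norm_circle_coeff_le[OF \<rho> slice_\<psi>] norm_circle_coeff_le[OF \<rho> slice_\<psi>'];
          use that \<rho> bd bd' in auto)+
    then show "\<bar>Re (C n r)\<bar> \<le> M / \<rho> ^ n * exp (- k * r)" if "r \<ge> 0" for r
      using order_trans[OF abs_Re_le_cmod] that by simp
    show "\<bar>Re (C' n r)\<bar> \<le> M / \<rho> ^ n * exp (- k * r)" if "r > 0" for r
      using order_trans[OF abs_Re_le_cmod C'_bd[of r]] that by simp
    show "continuous_on {0..} (\<lambda>r. Re (C n r))" "continuous_on {0<..} (\<lambda>r. Re (C' n r))"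
      by (intro continuous_intros continuous_on_subset[OF Ccont(1)] continuous_on_subset[OF Ccont(2)]; force)+
  qed
  moreover have "(\<lambda>N. H1_norm (\<lambda>x. F z x - (\<Sum>n<N. (z - z\<^sub>0) ^ n * Re (C n \<bar>x\<bar>)))) \<longlonglongrightarrow> 0"
    if z: "z \<in> I" "\<bar>z - z\<^sub>0\<bar> < \<rho>" for z
  proof -
    define \<theta> where "\<theta> = \<bar>z - z\<^sub>0\<bar> / \<rho>"
    have \<theta>: "0 \<le> \<theta>" "\<theta> < 1" using \<rho> z by (auto simp: \<theta>_def)
    have nz: "norm (complex_of_real z - of_real z\<^sub>0) = \<theta> * \<rho>"
      using \<rho> by (simp add: \<theta>_def flip: of_real_diff)
    have zb: "complex_of_real z \<in> cball (of_real z\<^sub>0) \<rho>"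
      using z by (simp add: dist_of_real dist_real_def abs_minus_commute)
    \<comment> \<open>The remainder after \<open>N\<close> terms as a function of \<open>r\<close>, and its derivative.\<close>
    define G where "G = (\<lambda>N r. Re (\<psi> z r - (\<Sum>n<N. C n r * (of_real z - of_real z\<^sub>0) ^ n)))"
    define G' where "G' = (\<lambda>N r. Re (\<psi>' z r - (\<Sum>n<N. C' n r * (of_real z - of_real z\<^sub>0) ^ n)))"
    have G_bd: "\<bar>G N r\<bar> \<le> (M * (\<theta> ^ N / (1 - \<theta>))) * exp (- k * r)" if "r \<ge> 0" for N r
    proof -
      have "norm (\<psi> z r - (\<Sum>n<N. C n r * (of_real z - of_real z\<^sub>0) ^ n))
              \<le> (M * exp (- k * r)) * (\<theta> ^ N / (1 - \<theta>))"
        unfolding C_def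
        by (rule circle_coeff_remainder[OF \<rho>]) (use slice_\<psi> hol bd nz \<theta> zb that in auto)
      from order_trans[OF abs_Re_le_cmod this] show ?thesis
        unfolding G_def by (simp only: mult_ac)
    qed
    have G'_bd: "\<bar>G' N r\<bar> \<le> (M * (\<theta> ^ N / (1 - \<theta>))) * exp (- k * r)" if "r \<ge> 0" for N r
    proof -
      have "norm (\<psi>' z r - (\<Sum>n<N. C' n r * (of_real z - of_real z\<^sub>0) ^ n))
              \<le> (M * exp (- k * r)) * (\<theta> ^ N / (1 - \<theta>))"
        unfolding C'_def
        by (rule circle_coeff_remainder[OF \<rho>]) (use slice_\<psi>' hol' bd' nz \<theta> zb that in auto)
      from order_trans[OF abs_Re_le_cmod this] show ?thesis
        unfolding G'_def by (simp only: mult_ac)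
    qed
    have G_deriv: "(G N has_real_derivative G' N r) (at r)" if "r > 0" for N r
      unfolding G_def G'_def
      by (rule real_deriv)
         (use that zb in \<open>auto intro!: derivative_intros deriv Cderiv has_vector_derivative_mult_left\<close>)
    have G_cont: "continuous_on {0..} (G N)" "continuous_on {0<..} (G' N)" for N
    proof -
      have "{0<..} \<subseteq> {0::real..}" by auto
      from continuous_on_subset[OF slice(2)[OF cont' order_refl zb] this]
        continuous_on_subset[OF Ccont(2) this]
      show "continuous_on {0<..} (G' N)"
        unfolding G'_def by (intro continuous_intros)
      show "continuous_on {0..} (G N)"
        unfolding G_def using slice(2)[OF cont order_refl zb] Ccont(1) by (intro continuous_intros)
    qed
    have eq: "F z x - (\<Sum>n<N. (z - z\<^sub>0) ^ n * Re (C n \<bar>x\<bar>)) = G N \<bar>x\<bar>" for N x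
      unfolding G_def F[OF z]
      by (simp add: mult.commute flip: of_real_diff of_real_power)
    have est: "0 \<le> H1_norm (\<lambda>x. G N \<bar>x\<bar>)"
      "H1_norm (\<lambda>x. G N \<bar>x\<bar>) \<le> (M * (\<theta> ^ N / (1 - \<theta>))) * decay_const k" for N
      using even_exp_decaying_H1(2,3)[OF k G_cont[of N] G_deriv[of _ N] G_bd[of _ N] G'_bd[of _ N]] by auto
    have "(\<lambda>N. \<theta> ^ N) \<longlonglongrightarrow> 0" using \<theta> by (intro LIMSEQ_power_zero) auto
    then have "(\<lambda>N. (M * (\<theta> ^ N / (1 - \<theta>))) * decay_const k) \<longlonglongrightarrow> (M * (0 / (1 - \<theta>))) * decay_const k"
      using \<theta> by (intro tendsto_mult tendsto_divide tendsto_const) auto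
    then show ?thesis
      unfolding eq mult_zero_left mult_zero_right div_0
      by (rule tendsto_sandwich[OF always_eventually always_eventually tendsto_const, rotated 2])
         (intro allI est)+
  qed
  ultimately show ?thesis
    using \<rho> by (intro exI[of _ \<rho>] exI[of _ "\<lambda>n x. Re (C n \<bar>x\<bar>)"] conjI allI ballI impI)
qed

section \<open>The point interaction on even functions\<close>

text \<open>
  For even functions the one-sided derivatives at the origin are \<open>g' 0\<close> and \<open>- g' 0\<close>, so the
  jump condition concerns \<open>2 * g' 0\<close>. Taking two classical derivatives away from the origin is enough, since
  the factor \<open>sgn x\<close> that appears in the first one is locally constant there.
\<close>

lemma even_delta_operator:
  fixes g g' g'' :: "real \<Rightarrow> real"
  assumes k: "k > 0"
    and deriv: "\<And>r. (g has_real_derivative g' r) (at r)"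
    and deriv': "\<And>r. (g' has_real_derivative g'' r) (at r)"
    and cont'': "continuous_on {0<..} g''"
    and bd: "\<And>r. r \<ge> 0 \<Longrightarrow> \<bar>g r\<bar> \<le> M * exp (- k * r)"
    and bd': "\<And>r. r \<ge> 0 \<Longrightarrow> \<bar>g' r\<bar> \<le> M * exp (- k * r)"
    and bd'': "\<And>r. r \<ge> 0 \<Longrightarrow> \<bar>g'' r\<bar> \<le> M * exp (- k * r)"
    and jump: "2 * g' 0 = - Z * g 0"
  shows "delta_operator Z (\<lambda>x. g \<bar>x\<bar>) (\<lambda>x. g'' \<bar>x\<bar>)"
proof -
  let ?u = "\<lambda>x. g \<bar>x\<bar>" and ?v = "\<lambda>x. sgn x * g' \<bar>x\<bar>" and ?h = "\<lambda>x. g'' \<bar>x\<bar>"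
  let ?S = "UNIV - {0::real}"
  have M: "M \<ge> 0" using bd[of 0] by auto
  have cont: "continuous_on A g" "continuous_on A g'" for A
    using deriv deriv' by (meson DERIV_isCont continuous_at_imp_continuous_on)+
  note H1 = even_exp_decaying_H1[OF k cont(1) cont(2) deriv bd bd']
  have bdv: "\<bar>?v x\<bar> \<le> M * exp (- k * \<bar>x\<bar>)" for x
    using bd'[of "\<bar>x\<bar>"] M by (cases "x = 0") (auto simp: abs_mult abs_sgn_eq)
  have "exp_decaying k M ?u"
    unfolding exp_decaying_def using bd
    by (auto intro!: continuous_intros continuous_on_compose2[OF cont(1)[of UNIV]])
  moreover have "exp_decaying k M ?v"
    unfolding exp_decaying_def using bdv
    by (auto intro!: continuous_intros continuous_on_compose2[OF cont(2)[of UNIV]])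
  moreover have "exp_decaying k M ?h"
    unfolding exp_decaying_def using bd''
    by (auto intro!: continuous_intros continuous_on_compose2[OF cont''])
  ultimately have UNIV_L2: "?u \<in> L2 UNIV" "?v \<in> L2 UNIV" "?h \<in> L2 UNIV"
    using exp_decaying_L2(1)[OF k] by auto
  then have L2: "?u \<in> L2 ?S" "?v \<in> L2 ?S" "?h \<in> L2 ?S"
    by (auto intro!: L2_subset)
  have du: "(?u has_real_derivative ?v x) (at x)" if "x \<noteq> 0" for x
    using DERIV_chain2[OF deriv has_real_derivative_abs[OF that]] by (simp add: mult.commute)
  have deriv_u: "deriv ?u x = ?v x" if "x \<noteq> 0" for x
    by (rule DERIV_imp_deriv[OF du[OF that]])
  have dv: "(?v has_real_derivative ?h x) (at x)" if "x \<noteq> 0" for x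
  proof -
    have "((\<lambda>y. sgn x * g' \<bar>y\<bar>) has_real_derivative sgn x * (g'' \<bar>x\<bar> * sgn x)) (at x)"
      by (rule DERIV_cmult[OF DERIV_chain2[OF deriv' has_real_derivative_abs[OF that]]])
    moreover have "sgn x * (g'' \<bar>x\<bar> * sgn x) = g'' \<bar>x\<bar>"
      using that by (cases "x > 0") auto
    moreover have "\<forall>\<^sub>F y in nhds x. sgn x = sgn y"
    proof (cases "x > 0")
      case True
      then show ?thesis
        using eventually_nhds_in_open[of "{0<..}" x] by (auto elim!: eventually_mono)
    next
      case False
      with that show ?thesis
        using eventually_nhds_in_open[of "{..<0}" x] by (auto elim!: eventually_mono)
    qed
    then have "\<forall>\<^sub>F y in nhds x. sgn x * g' \<bar>y\<bar> = sgn y * g' \<bar>y\<bar>"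
      by (auto elim: eventually_mono)
    ultimately show ?thesis
      using DERIV_cong_ev[OF refl] by fastforce
  qed
  have wu: "weak_deriv ?S ?u ?v"
    by (rule weak_deriv_of_classical) (use UNIV_L2 du in auto)
  have wv: "weak_deriv ?S ?v ?h"
    by (rule weak_deriv_of_classical) (use UNIV_L2 dv in auto)
  have "?u \<in> sobolev 2 ?S"
    using L2 wu wv by (auto simp: numeral_2_eq_2)
  moreover have "?u \<in> sobolev 1 UNIV" by (rule H1(1)) auto
  moreover have "continuous_on UNIV ?u"
    by (auto intro!: continuous_intros continuous_on_compose2[OF cont(1)[of UNIV]])
  moreover have "(deriv ?u \<longlongrightarrow> g' 0) (at_right 0)"
  proof (rule Lim_transform_eventually)
    have "isCont g' 0" using deriv' DERIV_isCont by blast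
    then show "(g' \<longlongrightarrow> g' 0) (at_right 0)"
      unfolding isCont_def by (rule tendsto_mono[rotated]) (simp add: at_le)
    show "\<forall>\<^sub>F x in at_right 0. g' x = deriv ?u x"
      by (rule eventually_mono[OF eventually_at_right_less]) (simp add: deriv_u)
  qed
  moreover have "(deriv ?u \<longlongrightarrow> - g' 0) (at_left 0)"
  proof (rule Lim_transform_eventually)
    have "isCont (\<lambda>x. - g' (- x)) 0"
      using continuous_on_compose2[OF cont(2)[of UNIV], of UNIV uminus]
      by (auto intro!: continuous_intros simp: continuous_on_eq_continuous_at)
    then have "((\<lambda>x. - g' (- x)) \<longlongrightarrow> - g' (- 0)) (at 0)"
      unfolding isCont_def by simp
    then show "((\<lambda>x. - g' (- x)) \<longlongrightarrow> - g' 0) (at_left 0)"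
      using tendsto_mono[OF at_le[of "{..<0}" UNIV 0]] by simp
    show "\<forall>\<^sub>F x in at_left 0. - g' (- x) = deriv ?u x"
      unfolding eventually_at_filter by (auto simp: deriv_u)
  qed
  moreover have "g' 0 - (- g' 0) = - Z * ?u 0" using jump by simp
  ultimately have "?u \<in> delta_domain Z"
    unfolding delta_domain_def by blast
  then show ?thesis
    unfolding delta_operator_def using L2 wu wv by blast
qed

section \<open>The profiles as equilibria\<close>

text \<open>
  The two parameter ranges of the theorem have in common that the number under the square root in the profile is positive.
\<close>

locale profile_parameters =
  fixes a b p w :: real
  assumes p: "p > 1" and a: "a > 0" and w: "w < 0"
    and discriminant: "(a / (p + 1))\<^sup>2 - b / p * w > 0"
begin

definition \<alpha> :: real where "\<alpha> = a / (p + 1)"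
definition D :: real where "D = sqrt (\<alpha>\<^sup>2 - b / p * w)"
definition k :: real where "k = sqrt (- w)"
definition c :: real where "c = (p - 1) * k"
definition A :: real where "A = \<alpha> / (- w)"
definition B :: real where "B = D / (- w)"
definition T :: real where "T = - 1 / (p - 1)"
abbreviation R :: "real \<Rightarrow> real" where "R \<equiv> R_fun a b p w"

lemma positive: "\<alpha> > 0" "D > 0" "k > 0" "c > 0" "A > 0" "B > 0"
proof -
  show "\<alpha> > 0" "D > 0" "k > 0"
    using p a w discriminant by (simp_all add: \<alpha>_def D_def k_def)
  then show "c > 0" "A > 0" "B > 0"
    using p w unfolding c_def A_def B_def by (intro mult_pos_pos divide_pos_pos; simp)+
qed

lemma T: "T < 0" "T * c = - k" "T * p = T - 1" "T * (2 * p - 1) = T - 2"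
  using p by (auto simp: T_def c_def field_simps)

lemma k_sq: "k\<^sup>2 = - w"
  using w by (simp add: k_def)

lemma D_sq: "D\<^sup>2 = \<alpha>\<^sup>2 - b / p * w"
  using discriminant by (simp add: D_def \<alpha>_def)

lemma R_eq: "R s = D * sinh (c * s) / (\<alpha> + D * cosh (c * s))"
  by (simp add: R_fun_def Let_def D_def \<alpha>_def c_def k_def)

lemma R_denominator_pos: "\<alpha> + D * cosh (c * s) > 0"
  using positive cosh_real_pos by (simp add: add_pos_pos)

text \<open>
  Since \<open>R\<close> is up to the factor \<open>- k\<close> the logarithmic derivative of the profile, its boundedness
  transfers the decay of the profile to the derivative.
\<close>

lemma abs_R_le_1: "\<bar>R s\<bar> \<le> 1"
proof -
  have "\<bar>sinh (c * s)\<bar> \<le> cosh (c * s)"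
    using sinh_le_cosh_real[of "c * s"] sinh_le_cosh_real[of "- (c * s)"] by auto
  then have "\<bar>D * sinh (c * s)\<bar> \<le> D * cosh (c * s)"
    using positive by (simp add: abs_mult)
  then show ?thesis
    using R_denominator_pos[of s] positive by (simp add: R_eq abs_divide)
qed

text \<open>
  Clearing denominators in \<open>R s = R t\<close> and applying the addition theorem leaves a sum of two terms that both
  have the sign of \<open>s - t\<close>.
\<close>

lemma inj_R: "inj R"
proof (rule linorder_injI)
  fix s t :: real assume "s < t"
  then have lt: "c * s < c * t" using positive by simp
  show "R s \<noteq> R t"
  proof
    assume "R s = R t"
    then have "sinh (c * s) * (\<alpha> + D * cosh (c * t)) = sinh (c * t) * (\<alpha> + D * cosh (c * s))"
      using R_denominator_pos[of s] R_denominator_pos[of t] positive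
      by (simp add: R_eq frac_eq_eq less_imp_neq[symmetric])
    then have "\<alpha> * (sinh (c * s) - sinh (c * t)) + D * sinh (c * s - c * t) = 0"
      unfolding sinh_diff by (simp add: algebra_simps)
    moreover have "\<alpha> * (sinh (c * s) - sinh (c * t)) < 0" "D * sinh (c * s - c * t) < 0"
      using lt positive by (auto simp: mult_less_0_iff sinh_real_less_iff)
    ultimately show False by linarith
  qed
qed

text \<open>
  The value of \<open>exp (c * s)\<close> for the solution \<open>s\<close> of \<open>R s = \<zeta>\<close>: with \<open>u
  = exp (c * s)\<close> this equation reads \<open>D * (1 - \<zeta>) * u\<^sup>2 - 2 * \<alpha> * \<zeta> * u - D * (1 +
  \<zeta>) = 0\<close>. For \<open>\<bar>\<zeta>\<bar> < 1\<close> the product of the roots is negative, and this is the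
  positive one.
\<close>

definition exp_shift :: "real \<Rightarrow> real" where
  "exp_shift \<zeta> = (\<alpha> * \<zeta> + sqrt (\<alpha>\<^sup>2 * \<zeta>\<^sup>2 + D\<^sup>2 * (1 - \<zeta>\<^sup>2))) / (D * (1 - \<zeta>))"

lemma radicand_pos:
  assumes "\<bar>\<zeta>\<bar> < 1"
  shows "\<alpha>\<^sup>2 * \<zeta>\<^sup>2 + D\<^sup>2 * (1 - \<zeta>\<^sup>2) > (\<alpha> * \<zeta>)\<^sup>2"
  using assms positive by (simp add: power_mult_distrib abs_square_less_1)

lemma exp_shift_pos:
  assumes "\<bar>\<zeta>\<bar> < 1"
  shows "exp_shift \<zeta> > 0"
proof -
  have "\<bar>\<alpha> * \<zeta>\<bar> < sqrt (\<alpha>\<^sup>2 * \<zeta>\<^sup>2 + D\<^sup>2 * (1 - \<zeta>\<^sup>2))"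
    using real_sqrt_less_mono[OF radicand_pos[OF assms]] by (simp only: real_sqrt_abs)
  then have "\<alpha> * \<zeta> + sqrt (\<alpha>\<^sup>2 * \<zeta>\<^sup>2 + D\<^sup>2 * (1 - \<zeta>\<^sup>2)) > 0" by linarith
  then show ?thesis using assms positive unfolding exp_shift_def by (intro divide_pos_pos mult_pos_pos) auto
qed

lemma exp_shift_quadratic:
  assumes "\<bar>\<zeta>\<bar> < 1"
  shows "D * ((exp_shift \<zeta>)\<^sup>2 - 1) = \<zeta> * (2 * \<alpha> * exp_shift \<zeta> + D * ((exp_shift \<zeta>)\<^sup>2 + 1))"
proof -
  define \<sigma> where "\<sigma> = sqrt (\<alpha>\<^sup>2 * \<zeta>\<^sup>2 + D\<^sup>2 * (1 - \<zeta>\<^sup>2))"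
  have \<sigma>: "\<sigma>\<^sup>2 = \<alpha>\<^sup>2 * \<zeta>\<^sup>2 + D\<^sup>2 * (1 - \<zeta>\<^sup>2)"
    unfolding \<sigma>_def by (rule real_sqrt_pow2) (use radicand_pos[OF assms] zero_le_power2[of "\<alpha> * \<zeta>"] in linarith)
  define E where "E = D * (1 - \<zeta>)"
  have E: "E > 0" using assms positive by (auto simp: E_def)
  have u: "E * exp_shift \<zeta> = \<alpha> * \<zeta> + \<sigma>" using E by (simp add: exp_shift_def E_def[symmetric] \<sigma>_def)
  have "E * (E * (exp_shift \<zeta>)\<^sup>2 - 2 * \<alpha> * \<zeta> * exp_shift \<zeta> - D * (1 + \<zeta>))
      = (E * exp_shift \<zeta>)\<^sup>2 - 2 * \<alpha> * \<zeta> * (E * exp_shift \<zeta>) - E * D * (1 + \<zeta>)"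
    by (simp add: algebra_simps power2_eq_square)
  also have "\<dots> = \<sigma>\<^sup>2 - (\<alpha> * \<zeta>)\<^sup>2 - E * D * (1 + \<zeta>)"
    unfolding u by (simp add: algebra_simps power2_eq_square)
  also have "\<dots> = 0"
    unfolding \<sigma> E_def by (simp add: algebra_simps power2_eq_square)
  finally have "E * (exp_shift \<zeta>)\<^sup>2 - 2 * \<alpha> * \<zeta> * exp_shift \<zeta> - D * (1 + \<zeta>) = 0" using E by simp
  then show ?thesis unfolding E_def by (simp add: algebra_simps)
qed

text \<open>
  The logarithm of the positive root, divided by \<open>c\<close>, solves \<open>R s = \<zeta>\<close>, and by injectivity
  no other number does. So the inverse function is explicit, and its values are actual preimages.
\<close>

lemma inv_R:
  assumes "\<bar>\<zeta>\<bar> < 1"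
  shows "exp (c * inv R \<zeta>) = exp_shift \<zeta>" and "R (inv R \<zeta>) = \<zeta>"
proof -
  define s where "s = ln (exp_shift \<zeta>) / c"
  let ?u = "exp_shift \<zeta>"
  have u: "?u > 0" by (rule exp_shift_pos[OF assms])
  have cs: "c * s = ln ?u" using positive by (simp add: s_def)
  have "R s = \<zeta> \<longleftrightarrow> D * sinh (c * s) = \<zeta> * (\<alpha> + D * cosh (c * s))"
    using R_denominator_pos[of s] by (simp add: R_eq divide_eq_eq)
  also have "\<dots> \<longleftrightarrow> D * ((?u - inverse ?u) / 2) = \<zeta> * (\<alpha> + D * ((?u + inverse ?u) / 2))"
    using u by (simp only: cs cosh_ln_real sinh_ln_real)
  also have "\<dots> \<longleftrightarrow> D * (?u\<^sup>2 - 1) = \<zeta> * (2 * \<alpha> * ?u + D * (?u\<^sup>2 + 1))"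
  proof -
    have "D * (?u\<^sup>2 - 1) = 2 * ?u * (D * ((?u - inverse ?u) / 2))"
      "\<zeta> * (2 * \<alpha> * ?u + D * (?u\<^sup>2 + 1)) = 2 * ?u * (\<zeta> * (\<alpha> + D * ((?u + inverse ?u) / 2)))"
      using u by (simp_all add: field_simps power2_eq_square)
    then show ?thesis using u by (metis mult_cancel_left mult_pos_pos less_irrefl zero_less_numeral)
  qed
  finally have "R s = \<zeta>" using exp_shift_quadratic[OF assms] by simp
  moreover from this have "inv R \<zeta> = s" using inv_f_f[OF inj_R] by metis
  ultimately show "R (inv R \<zeta>) = \<zeta>" "exp (c * inv R \<zeta>) = exp_shift \<zeta>" using cs u by auto
qed

definition base :: "real \<Rightarrow> real \<Rightarrow> real" where
  "base s r = A + B * cosh (c * (r + s))"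

lemma profile_eq: "profile a b p w Z x = base (inv R (Z / (2 * k))) \<bar>x\<bar> powr T"
  by (simp add: profile_def Let_def base_def A_def B_def D_def \<alpha>_def T_def c_def k_def)

lemma base_ge_A: "base s r \<ge> A"
  using positive cosh_real_pos[of "c * (r + s)"] by (simp add: base_def)

lemma base_pos: "base s r > 0"
  using base_ge_A[of s r] positive by linarith

lemma R_eq_base: "R (r + s) = B * sinh (c * (r + s)) / base s r"
proof -
  have "base s r = (\<alpha> + D * cosh (c * (r + s))) / (- w)"
    by (simp add: base_def A_def B_def add_divide_distrib)
  then show ?thesis using w by (simp add: R_eq B_def)
qed

lemma DERIV_base: "(base s has_real_derivative B * c * sinh (c * (r + s))) (at r)"
  unfolding base_def by (auto intro!: derivative_eq_intros)

text \<open>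
  The exponents are such that \<open>T * c = - k\<close>, which turns the logarithmic derivative \<open>T * y' / y\<close>
  of the profile, where \<open>y = base s r\<close>, into \<open>- k * R\<close>.
\<close>

lemma DERIV_profile:
  "((\<lambda>r. base s r powr T) has_real_derivative - k * (base s r powr T) * R (r + s)) (at r)"
proof -
  have "((\<lambda>r. base s r powr T) has_real_derivative
          T * base s r powr (T - 1) * (B * c * sinh (c * (r + s)))) (at r)"
    using DERIV_fun_powr[OF DERIV_base base_pos] by simp
  also have "T * base s r powr (T - 1) * (B * c * sinh (c * (r + s))) =
      (T * c) * (base s r powr T) * (B * sinh (c * (r + s)) / base s r)"
    using base_pos[of s r] by (simp add: powr_diff)
  also have "\<dots> = - k * (base s r powr T) * R (r + s)"
    by (simp only: T R_eq_base)
  finally show ?thesis .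
qed

lemma DERIV_R:
  "((\<lambda>r. R (r + s)) has_real_derivative
     (c * B * cosh (c * (r + s)) * base s r - c * (B * sinh (c * (r + s)))\<^sup>2) / (base s r)\<^sup>2) (at r)"
  unfolding R_eq_base
  by (rule derivative_eq_intros DERIV_base refl | use base_pos[of s r] in \<open>simp add: power2_eq_square algebra_simps\<close>)+

text \<open>
  Let \<open>y = base s r\<close> and \<open>g = y powr T\<close>. Differentiating \<open>g' = - k * g * R\<close> gives
  \<open>g'' = g * (k\<^sup>2 * R\<^sup>2 - k * R')\<close>. The factor is a rational function of \<open>sinh\<close> and
  \<open>cosh\<close> with denominator \<open>y\<^sup>2\<close>; after elimination of \<open>sinh\<close> and
  \<open>cosh\<close> in favour of \<open>y\<close> its numerator is a quadratic polynomial in \<open>y\<close>. The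
  values of \<open>A\<close> and \<open>B\<close> are those for which its lower coefficients are \<open>- a\<close> and
  \<open>- b\<close>.
\<close>

lemma profile_ode_coefficient:
  "k\<^sup>2 * (R (r + s))\<^sup>2
     - k * ((c * B * cosh (c * (r + s)) * base s r - c * (B * sinh (c * (r + s)))\<^sup>2) / (base s r)\<^sup>2)
   = - w - a / base s r - b / (base s r)\<^sup>2"
proof -
  define Y where "Y = base s r"
  define C where "C = B * cosh (c * (r + s))"
  define S where "S = B * sinh (c * (r + s))"
  have Y: "Y > 0" "Y = A + C" using base_pos by (auto simp: Y_def base_def C_def)
  have S: "S\<^sup>2 = C\<^sup>2 - B\<^sup>2"
    unfolding S_def C_def power_mult_distrib cosh_square_eq by (simp add: algebra_simps)
  have kc: "k * c = - w * (p - 1)" using k_sq by (simp add: c_def power2_eq_square mult.assoc[symmetric] mult.commute)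
  have wA: "- w * A * (p + 1) = a" using w p by (simp add: A_def \<alpha>_def)
  have wAB: "- w * p * (A\<^sup>2 - B\<^sup>2) = - b"
  proof -
    have "A\<^sup>2 - B\<^sup>2 = (\<alpha>\<^sup>2 - D\<^sup>2) / w\<^sup>2" by (simp add: A_def B_def power_divide diff_divide_distrib)
    then show ?thesis using w p unfolding D_sq by (simp add: field_simps power2_eq_square)
  qed
  have "- w * S\<^sup>2 - (k * c) * (C * Y - S\<^sup>2) = - w * Y\<^sup>2 - (- w * A * (p + 1)) * Y + (- w * p * (A\<^sup>2 - B\<^sup>2))"
    unfolding kc S Y(2) by (simp add: algebra_simps power2_eq_square)
  then have "- w * S\<^sup>2 - (k * c) * (C * Y - S\<^sup>2) = - w * Y\<^sup>2 - a * Y - b"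
    unfolding wA wAB by simp
  moreover have "- w * (S / Y)\<^sup>2 - k * ((c * C * Y - c * S\<^sup>2) / Y\<^sup>2)
      = (- w * S\<^sup>2 - (k * c) * (C * Y - S\<^sup>2)) / Y\<^sup>2"
    by (simp add: power_divide diff_divide_distrib right_diff_distrib mult.assoc)
  moreover have "(- w * Y\<^sup>2 - a * Y - b) / Y\<^sup>2 = - w - a / Y - b / Y\<^sup>2"
    using Y(1) by (simp add: diff_divide_distrib power2_eq_square)
  ultimately show ?thesis
    unfolding R_eq_base Y_def[symmetric] S_def[symmetric] k_sq C_def mult.assoc by simp
qed

lemma DERIV2_profile:
  "((\<lambda>r. - k * (base s r powr T) * R (r + s)) has_real_derivative
     (base s r powr T) * (- w - a / base s r - b / (base s r)\<^sup>2)) (at r)"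
proof -
  have "((\<lambda>r. - k * (base s r powr T) * R (r + s)) has_real_derivative
     - k * (- k * (base s r powr T) * R (r + s)) * R (r + s) +
     (c * B * cosh (c * (r + s)) * base s r - c * (B * sinh (c * (r + s)))\<^sup>2) / (base s r)\<^sup>2
       * (- k * (base s r powr T))) (at r)"
    by (rule DERIV_mult[OF DERIV_cmult[OF DERIV_profile] DERIV_R])
  then show ?thesis
    unfolding profile_ode_coefficient[symmetric]
    by (rule DERIV_cong) (simp only: power2_eq_square algebra_simps)
qed

lemma profile_decay:
  assumes "r \<ge> 0"
  shows "base s r powr T \<le> (B / 2 * exp (c * s)) powr T * exp (- k * r)"
proof -
  have "B / 2 * exp (c * s) * exp (c * r) \<le> base s r"
    using positive by (simp add: base_def cosh_def exp_add[symmetric] distrib_left add.commute field_simps)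
  then have "base s r powr T \<le> (B / 2 * exp (c * s) * exp (c * r)) powr T"
    using positive T(1) by (intro powr_mono2') auto
  also have "\<dots> = (B / 2 * exp (c * s)) powr T * exp (c * r) powr T"
    by (rule powr_mult)
  also have "exp (c * r) powr T = exp (T * c * r)"
    by (simp add: exp_powr_real mult_ac)
  finally show ?thesis unfolding T .
qed

text \<open>
  The differential equation holds at every point once the powers of the profile are expressed through \<open>y = base s
  r\<close>. Membership in the domain needs the decay of the profile and of two derivatives, which are products of the
  profile with bounded functions, because \<open>\<bar>R\<bar> \<le> 1\<close> and \<open>y \<ge> A > 0\<close>.
\<close>

theorem profile_equilibrium:
  assumes Z: "\<bar>Z / (2 * k)\<bar> < 1"
  shows "equilibrium a b p w Z (profile a b p w Z)"
proof -
  define s where "s = inv R (Z / (2 * k))"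
  have Rs: "R s = Z / (2 * k)" unfolding s_def by (rule inv_R(2)[OF Z])
  let ?g = "\<lambda>r. base s r powr T" and ?g' = "\<lambda>r. - k * (base s r powr T) * R (r + s)"
  let ?g'' = "\<lambda>r. (base s r powr T) * (- w - a / base s r - b / (base s r)\<^sup>2)"
  define K where "K = (B / 2 * exp (c * s)) powr T"
  define N where "N = 1 + k + (- w + a / A + \<bar>b\<bar> / A\<^sup>2)"
  have N: "1 \<le> N" "k \<le> N" "- w + a / A + \<bar>b\<bar> / A\<^sup>2 \<le> N"
  proof -
    have "0 \<le> - w" "0 \<le> a / A" "0 \<le> \<bar>b\<bar> / A\<^sup>2" using positive a w by auto
    then show "1 \<le> N" "k \<le> N" "- w + a / A + \<bar>b\<bar> / A\<^sup>2 \<le> N"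
      using positive(3) unfolding N_def by linarith+
  qed
  have gK: "?g r * t \<le> (K * N) * exp (- k * r)" if "r \<ge> 0" "0 \<le> t" "t \<le> N" for r t
  proof -
    have "?g r * t \<le> (K * exp (- k * r)) * N"
      unfolding K_def using that N profile_decay[OF that(1), of s] by (intro mult_mono) auto
    then show ?thesis by (simp add: mult_ac)
  qed
  have "delta_operator Z (\<lambda>x. ?g \<bar>x\<bar>) (\<lambda>x. ?g'' \<bar>x\<bar>)"
  proof (rule even_delta_operator[OF positive(3) DERIV_profile DERIV2_profile, where M = "K * N"])
    show "continuous_on {0<..} ?g''"
      unfolding base_def
      by (intro continuous_intros) (use base_pos[of s] in \<open>auto simp: base_def less_imp_neq[symmetric]\<close>)
    fix r :: real assume r: "r \<ge> 0"
    show "\<bar>?g r\<bar> \<le> K * N * exp (- k * r)" using gK[OF r, of 1] N by simp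
    have "\<bar>?g' r\<bar> = ?g r * (k * \<bar>R (r + s)\<bar>)" using positive by (simp add: abs_mult)
    also have "\<dots> \<le> K * N * exp (- k * r)"
      using order_trans[OF mult_left_mono[OF abs_R_le_1[of "r + s"], of k]] N(2) positive(3)
      by (intro gK[OF r]) auto
    finally show "\<bar>?g' r\<bar> \<le> K * N * exp (- k * r)" .
    have y1: "a / base s r \<le> a / A" "0 \<le> a / base s r"
      using base_ge_A[of s r] positive base_pos[of s r] a by (auto intro!: divide_left_mono)
    have y2: "\<bar>b / (base s r)\<^sup>2\<bar> \<le> \<bar>b\<bar> / A\<^sup>2"
      using base_ge_A[of s r] positive base_pos[of s r]
      by (auto simp: abs_divide intro!: divide_left_mono power_mono)
    have "\<bar>- w - a / base s r - b / (base s r)\<^sup>2\<bar> \<le> N"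
      using y1 y2 w N(3) by linarith
    from gK[OF r _ this] show "\<bar>?g'' r\<bar> \<le> K * N * exp (- k * r)"
      by (simp add: abs_mult)
  next
    show "2 * ?g' 0 = - Z * ?g 0" using Rs positive by simp
  qed
  moreover have "?g'' \<bar>x\<bar> + w * ?g \<bar>x\<bar> + a * ?g \<bar>x\<bar> powr p + b * ?g \<bar>x\<bar> powr (2 * p - 1) = 0" for x
  proof -
    have "?g \<bar>x\<bar> powr p = ?g \<bar>x\<bar> / base s \<bar>x\<bar>" "?g \<bar>x\<bar> powr (2 * p - 1) = ?g \<bar>x\<bar> / (base s \<bar>x\<bar>)\<^sup>2"
      using base_pos[of s "\<bar>x\<bar>"] unfolding powr_powr T by (simp_all add: powr_diff)
    then show ?thesis by (simp add: algebra_simps)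
  qed
  moreover have "profile a b p w Z = (\<lambda>x. ?g \<bar>x\<bar>)"
    by (simp add: fun_eq_iff profile_eq s_def)
  ultimately show ?thesis unfolding equilibrium_def by auto
qed

section \<open>Analytic dependence of the profiles on the strength of the interaction\<close>

definition complex_exp_shift :: "complex \<Rightarrow> complex" where
  "complex_exp_shift \<zeta> = (\<alpha> * \<zeta> + csqrt (\<alpha>\<^sup>2 * \<zeta>\<^sup>2 + D\<^sup>2 * (1 - \<zeta>\<^sup>2))) / (D * (1 - \<zeta>))"
  for \<zeta> :: complex

lemma complex_exp_shift_of_real:
  assumes "\<bar>\<zeta>\<bar> < 1"
  shows "complex_exp_shift (of_real \<zeta>) = of_real (exp_shift \<zeta>)"
proof -
  have "\<alpha>\<^sup>2 * \<zeta>\<^sup>2 + D\<^sup>2 * (1 - \<zeta>\<^sup>2) \<ge> 0"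
    using radicand_pos[OF assms] zero_le_power2[of "\<alpha> * \<zeta>"] by linarith
  from of_real_sqrt[OF this] show ?thesis
    by (simp add: complex_exp_shift_def exp_shift_def)
qed

text \<open>
  The strength of the interaction enters the profile only through this function: for real \<open>z\<close> with
  \<open>\<bar>z\<bar> < 2 * k\<close> it is \<open>exp (c * s)\<close>, where \<open>s\<close> is the shift of the
  profile for the strength \<open>z\<close>.
\<close>

definition U :: "complex \<Rightarrow> complex" where
  "U z = complex_exp_shift (z / (2 * complex_of_real k))"

text \<open>
  At real \<open>z\<^sub>0\<close> with \<open>\<bar>z\<^sub>0\<bar> < 2 * k\<close> both the radicand and
  \<open>U\<close> itself are positive. So on a small disc the radicand avoids the branch cut of the square root, the
  denominator \<open>1 - \<zeta>\<close> does not vanish, and the real part of \<open>U\<close> stays above half of its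
  central value.
\<close>

lemma U_near_real:
  assumes Z: "\<bar>z\<^sub>0 / (2 * k)\<bar> < 1"
  obtains \<rho> \<delta> where "\<rho> > 0" "\<delta> > 0"
    "U holomorphic_on cball (of_real z\<^sub>0) \<rho>"
    "\<And>z. z \<in> cball (of_real z\<^sub>0) \<rho> \<Longrightarrow> Re (U z) \<ge> \<delta>"
proof -
  define Q where "Q = (\<lambda>z. z / (2 * complex_of_real k))"
  define rad where "rad = (\<lambda>z. of_real (\<alpha>\<^sup>2) * (Q z)\<^sup>2 + of_real (D\<^sup>2) * (1 - (Q z)\<^sup>2))"
  define \<delta> where "\<delta> = exp_shift (z\<^sub>0 / (2 * k)) / 2"
  have \<delta>: "\<delta> > 0" using exp_shift_pos[OF Z] by (simp add: \<delta>_def)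
  have U: "U = (\<lambda>z. (of_real \<alpha> * Q z + csqrt (rad z)) / (of_real D * (1 - Q z)))"
    by (simp add: U_def complex_exp_shift_def rad_def Q_def fun_eq_iff)
  define P where "P = {z. Re (rad z) > 0} \<inter> {z. Re (Q z) < 1}"
  have opP: "open P"
    unfolding P_def rad_def Q_def
    by (intro open_Int open_Collect_less continuous_intros) (use positive in auto)
  have ne: "1 - Q z \<noteq> 0" if "z \<in> P" for z
    using that by (auto simp: P_def)
  have holQ: "Q holomorphic_on P"
    unfolding Q_def by (intro holomorphic_intros) (use positive in auto)
  have "rad z \<notin> \<real>\<^sub>\<le>\<^sub>0" if "z \<in> P" for z
    using that by (auto simp: P_def complex_nonpos_Reals_iff)
  then have hol: "U holomorphic_on P"
    unfolding U unfolding rad_def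
    by (intro holomorphic_intros holQ) (use positive ne in auto)
  define P' where "P' = P \<inter> (\<lambda>z. Re (U z)) -` {\<delta><..}"
  have "open P'"
    unfolding P'_def
    by (intro continuous_open_preimage[OF _ opP] continuous_intros holomorphic_on_imp_continuous_on[OF hol])
  moreover have "of_real z\<^sub>0 \<in> P'"
  proof -
    have Q: "Q (of_real z\<^sub>0) = of_real (z\<^sub>0 / (2 * k))" by (simp add: Q_def)
    have "rad (of_real z\<^sub>0) = of_real (\<alpha>\<^sup>2 * (z\<^sub>0 / (2 * k))\<^sup>2 + D\<^sup>2 * (1 - (z\<^sub>0 / (2 * k))\<^sup>2))"
      unfolding rad_def Q by simp
    then have "Re (rad (of_real z\<^sub>0)) > 0"
      using radicand_pos[OF Z] zero_le_power2[of "\<alpha> * (z\<^sub>0 / (2 * k))"] by (simp only: Re_complex_of_real)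
    moreover have "Re (U (of_real z\<^sub>0)) = 2 * \<delta>"
      using complex_exp_shift_of_real[OF Z] by (simp add: \<delta>_def U_def)
    moreover have "Re (Q (of_real z\<^sub>0)) < 1"
      unfolding Q Re_complex_of_real using Z by linarith
    ultimately show ?thesis
      using \<delta> by (simp add: P'_def P_def)
  qed
  ultimately obtain \<rho> where \<rho>: "\<rho> > 0" "cball (of_real z\<^sub>0) \<rho> \<subseteq> P'"
    using open_contains_cball by blast
  show ?thesis
  proof (rule that[OF \<rho>(1) \<delta>])
    show "U holomorphic_on cball (of_real z\<^sub>0) \<rho>"
      by (rule holomorphic_on_subset[OF hol]) (use \<rho> in \<open>auto simp: P'_def\<close>)
    show "Re (U z) \<ge> \<delta>" if "z \<in> cball (of_real z\<^sub>0) \<rho>" for z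
      using \<rho> that by (auto simp: P'_def)
  qed
qed

text \<open>
  Multiplying \<open>A + B * cosh (c * (r + s))\<close> by \<open>exp (- c * r)\<close> and writing \<open>u\<close> for
  \<open>exp (c * s)\<close> gives this expression. As long as the real part of \<open>u\<close> is bounded below by a
  positive number, it stays away from zero uniformly in real \<open>r\<close>, and the factor pulled out accounts for the
  exponential decay of the profile. The argument \<open>r\<close> is complex so that derivatives can be computed as
  complex derivatives.
\<close>

definition scaled_base :: "complex \<Rightarrow> complex \<Rightarrow> complex" where
  "scaled_base u r = A * exp (- c * r) + B / 2 * (u + exp (- 2 * c * r) / u)"
  for u r :: complex

definition scaled_base' :: "complex \<Rightarrow> complex \<Rightarrow> complex" where
  "scaled_base' u r = - c * A * exp (- c * r) - B * c * exp (- 2 * c * r) / u"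
  for u r :: complex

definition complex_profile :: "complex \<Rightarrow> complex \<Rightarrow> complex" where
  "complex_profile u r = exp (- k * r + T * Ln (scaled_base u r))"
  for u r :: complex

definition complex_profile' :: "complex \<Rightarrow> complex \<Rightarrow> complex" where
  "complex_profile' u r = complex_profile u r * (- k + T * (scaled_base' u r / scaled_base u r))"
  for u r :: complex

lemma scaled_base_of_real:
  "scaled_base u (of_real r) =
     of_real (A * exp (- c * r)) + of_real (B / 2) * (u + of_real (exp (- 2 * c * r)) / u)"
  by (simp add: scaled_base_def flip: exp_of_real)

text \<open>
  Inversion preserves the right half-plane, so all three summands have nonnegative real part and the one with
  \<open>u\<close> alone gives the bound. This keeps the logarithm off its branch cut.
\<close>

lemma Re_scaled_base_ge:
  assumes "Re u \<ge> \<delta>" "\<delta> > 0"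
  shows "Re (scaled_base u (of_real r)) \<ge> B / 2 * \<delta>"
proof -
  have "Re (of_real (exp (- 2 * c * r)) / u) \<ge> 0"
    using assms by (simp add: Re_divide)
  then have "B / 2 * (Re u + Re (of_real (exp (- 2 * c * r)) / u)) \<ge> B / 2 * \<delta>"
    using assms positive by (intro mult_left_mono) auto
  moreover have "A * exp (- c * r) \<ge> 0"
    using positive by simp
  moreover have "Re (of_real t * v) = t * Re v" for t v by simp
  ultimately show ?thesis
    unfolding scaled_base_of_real plus_complex.sel Re_complex_of_real by simp
qed

lemma scaled_base_slit:
  assumes "Re u \<ge> \<delta>" "\<delta> > 0"
  shows "scaled_base u (of_real r) \<notin> \<real>\<^sub>\<le>\<^sub>0" "scaled_base u (of_real r) \<noteq> 0" "u \<noteq> 0"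
proof -
  have "B / 2 * \<delta> > 0" using positive assms by simp
  with Re_scaled_base_ge[OF assms, of r] have "Re (scaled_base u (of_real r)) > 0" by linarith
  then show "scaled_base u (of_real r) \<notin> \<real>\<^sub>\<le>\<^sub>0" "scaled_base u (of_real r) \<noteq> 0"
    by (auto simp: complex_nonpos_Reals_iff)
  show "u \<noteq> 0" using assms by auto
qed

lemma complex_profile_has_vector_derivative:
  assumes "Re u \<ge> \<delta>" "\<delta> > 0"
  shows "((\<lambda>r. complex_profile u (of_real r)) has_vector_derivative complex_profile' u (of_real r)) (at r within S)"
proof (rule has_vector_derivative_real_field)
  note ne = scaled_base_slit(1,2)[OF assms, of r] scaled_base_slit(3)[OF assms]
  have dG: "(scaled_base u has_field_derivative scaled_base' u (of_real r)) (at (of_real r))"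
    unfolding scaled_base_def scaled_base'_def
    by (rule derivative_eq_intros refl | use ne in \<open>simp add: field_simps\<close>)+
  show "(complex_profile u has_field_derivative complex_profile' u (of_real r)) (at (of_real r))"
    unfolding complex_profile_def complex_profile'_def
    by (rule derivative_eq_intros dG refl | use ne in \<open>simp add: field_simps\<close>)+
qed

text \<open>
  For \<open>Re u \<ge> \<delta>\<close> and \<open>r \<ge> 0\<close>, the first factor bounds the power of
  \<open>scaled_base\<close>, whose exponent \<open>T\<close> is negative. The last summand bounds
  \<open>\<bar>T\<bar>\<close> times the logarithmic derivative of \<open>scaled_base\<close>.
\<close>

definition decay_bound :: "real \<Rightarrow> real" where
  "decay_bound \<delta> = exp (T * ln (B / 2 * \<delta>)) * (1 + k + \<bar>T\<bar> * (c * (A + B / \<delta>) / (B / 2 * \<delta>)))"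

lemma complex_profile_decay:
  assumes u: "Re u \<ge> \<delta>" "\<delta> > 0" and r: "r \<ge> 0"
  shows "norm (complex_profile u (of_real r)) \<le> decay_bound \<delta> * exp (- k * r)"
    and "norm (complex_profile' u (of_real r)) \<le> decay_bound \<delta> * exp (- k * r)"
proof -
  define \<gamma> where "\<gamma> = B / 2 * \<delta>"
  define L where "L = c * (A + B / \<delta>) / \<gamma>"
  define E where "E = exp (T * ln \<gamma>) * exp (- k * r)"
  have \<gamma>: "\<gamma> > 0" using u positive by (simp add: \<gamma>_def)
  have L: "L \<ge> 0" using u positive \<gamma> by (simp add: L_def)
  have E: "E \<ge> 0" by (simp add: E_def)
  have bound: "decay_bound \<delta> * exp (- k * r) = E * (1 + k + \<bar>T\<bar> * L)"
    by (simp add: decay_bound_def E_def L_def \<gamma>_def)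
  have normG: "norm (scaled_base u (of_real r)) \<ge> \<gamma>"
    using Re_scaled_base_ge[OF u, of r] complex_Re_le_cmod[of "scaled_base u (of_real r)"] by (simp add: \<gamma>_def)
  have normu: "norm u \<ge> \<delta>" using u complex_Re_le_cmod[of u] by simp
  have "norm (complex_profile u (of_real r)) = exp (- k * r + T * ln (norm (scaled_base u (of_real r))))"
    unfolding complex_profile_def norm_exp_eq_Re using scaled_base_slit(2)[OF u, of r] by simp
  also have "\<dots> \<le> exp (- k * r + T * ln \<gamma>)"
    using T(1) ln_mono[OF normG \<gamma>] by (simp add: mult_left_mono_neg)
  finally have n_profile: "norm (complex_profile u (of_real r)) \<le> E" 
    unfolding E_def exp_add[symmetric] by (simp only: add.commute)
  moreover have "E * 1 \<le> E * (1 + k + \<bar>T\<bar> * L)"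
    using positive L E by (intro mult_left_mono) auto
  ultimately show "norm (complex_profile u (of_real r)) \<le> decay_bound \<delta> * exp (- k * r)"
    unfolding bound by simp
  have "norm (scaled_base' u (of_real r))
      \<le> norm (of_real (- c * A) * exp (of_real (- c) * of_real r :: complex))
        + norm (of_real (B * c) * exp (of_real (- 2 * c) * of_real r) / u)"
    unfolding scaled_base'_def by (rule norm_triangle_ineq4)
  also have "norm (of_real (- c * A) * exp (of_real (- c) * of_real r :: complex)) \<le> c * A"
    using positive r by (simp add: norm_mult)
  also have "norm (of_real (B * c) * exp (of_real (- 2 * c) * of_real r) / u) \<le> B * c / \<delta>"
    unfolding norm_divide
    by (rule frac_le) (use positive r normu u in \<open>auto simp: norm_mult\<close>)
  finally have "norm (scaled_base' u (of_real r)) \<le> c * (A + B / \<delta>)" by (simp add: algebra_simps)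
  then have nL: "norm (scaled_base' u (of_real r) / scaled_base u (of_real r)) \<le> L"
    unfolding norm_divide L_def using normG \<gamma> by (intro frac_le) (auto intro: order_trans[OF norm_ge_zero])
  have "norm (of_real (- k) + of_real T * (scaled_base' u (of_real r) / scaled_base u (of_real r)))
      \<le> norm (of_real (- k) :: complex) + norm (of_real T * (scaled_base' u (of_real r) / scaled_base u (of_real r)))"
    by (rule norm_triangle_ineq)
  also have "\<dots> \<le> k + \<bar>T\<bar> * L"
    using mult_left_mono[OF nL, of "\<bar>T\<bar>"] positive(3) unfolding norm_mult norm_of_real by simp
  finally have "norm (of_real (- k) + of_real T * (scaled_base' u (of_real r) / scaled_base u (of_real r))) \<le> 1 + k + \<bar>T\<bar> * L"
    by simp
  then have "norm (complex_profile' u (of_real r)) \<le> E * (1 + k + \<bar>T\<bar> * L)"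
    unfolding complex_profile'_def norm_mult using n_profile E by (intro mult_mono) auto
  then show "norm (complex_profile' u (of_real r)) \<le> decay_bound \<delta> * exp (- k * r)"
    unfolding bound .
qed

text \<open>
  For real strength, \<open>T * c = - k\<close> makes the factor \<open>exp (- k * r)\<close> cancel against the power of
  the factor \<open>exp (- c * r)\<close> in \<open>scaled_base\<close>.
\<close>

lemma profile_eq_Re_complex_profile:
  assumes "\<bar>Z / (2 * k)\<bar> < 1"
  shows "profile a b p w Z x = Re (complex_profile (U (of_real Z)) (of_real \<bar>x\<bar>))"
proof -
  define \<zeta> where "\<zeta> = Z / (2 * k)"
  define s where "s = inv R \<zeta>"
  define Y where "Y = base s \<bar>x\<bar>"
  have \<zeta>: "\<bar>\<zeta>\<bar> < 1" using assms by (simp add: \<zeta>_def)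
  have Y: "Y > 0" by (simp add: Y_def base_pos)
  have "U (of_real Z) = of_real (exp (c * s))"
    using complex_exp_shift_of_real[OF \<zeta>] inv_R(1)[OF \<zeta>] by (simp add: U_def \<zeta>_def s_def)
  moreover have "scaled_base (of_real (exp (c * s))) (of_real \<bar>x\<bar>) = of_real (exp (- c * \<bar>x\<bar>) * Y)"
  proof -
    have "exp (- c * \<bar>x\<bar>) * Y
      = A * exp (- c * \<bar>x\<bar>) + B / 2 * (exp (c * s) + exp (- 2 * c * \<bar>x\<bar>) / exp (c * s))"
      unfolding Y_def base_def cosh_def
      by (simp add: distrib_left exp_add[symmetric] exp_diff[symmetric] exp_minus[symmetric])
         (simp add: algebra_simps exp_add[symmetric] exp_diff[symmetric])
    then show ?thesis unfolding scaled_base_of_real by simp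
  qed
  ultimately have "complex_profile (U (of_real Z)) (of_real \<bar>x\<bar>)
      = exp (of_real (- k * \<bar>x\<bar> + T * ln (exp (- c * \<bar>x\<bar>) * Y)))"
    using Y by (simp add: complex_profile_def Ln_of_real del: of_real_mult) simp
  also have "- k * \<bar>x\<bar> + T * ln (exp (- c * \<bar>x\<bar>) * Y) = T * ln Y - (k + T * c) * \<bar>x\<bar>"
    using Y by (simp add: ln_mult algebra_simps)
  also have "\<dots> = T * ln Y" by (simp add: T)
  finally show ?thesis
    using Y by (simp add: Re_exp profile_eq powr_def Y_def s_def \<zeta>_def)
qed

text \<open>
  On the disc where \<open>U\<close> has real part at least \<open>\<delta> > 0\<close>, the complex profiles form a
  family as required by the criterion, with a bound that depends on \<open>\<delta>\<close> only.
\<close>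

theorem profile_analytic:
  "real_analytic_H1_on (\<lambda>z. profile a b p w z) {- 2 * k<..<2 * k}"
  unfolding real_analytic_H1_on_def
proof (intro conjI ballI)
  let ?I = "{- 2 * k<..<2 * k}"
  have small: "\<bar>z / (2 * k)\<bar> < 1" if "z \<in> ?I" for z
    using that positive by (auto simp: abs_less_iff field_simps)
  show "profile a b p w z \<in> sobolev 1 UNIV" if "z \<in> ?I" for z
    using profile_equilibrium[OF small[OF that]]
    by (auto simp: equilibrium_def delta_operator_def delta_domain_def)
  fix z\<^sub>0 assume "z\<^sub>0 \<in> ?I"
  from U_near_real[OF small[OF this]] obtain \<rho> \<delta> where \<rho>: "\<rho> > 0" and \<delta>: "\<delta> > 0"
    and hol: "U holomorphic_on cball (of_real z\<^sub>0) \<rho>"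
    and Re_ge: "\<And>z. z \<in> cball (of_real z\<^sub>0) \<rho> \<Longrightarrow> Re (U z) \<ge> \<delta>"
    by metis
  let ?K = "cball (complex_of_real z\<^sub>0) \<rho>"
  have slit: "scaled_base (U z) (of_real r) \<notin> \<real>\<^sub>\<le>\<^sub>0" "scaled_base (U z) (of_real r) \<noteq> 0" "U z \<noteq> 0"
    if "z \<in> ?K" for z r
    using scaled_base_slit[OF Re_ge[OF that] \<delta>] by blast+
  have holG: "(\<lambda>z. scaled_base (U z) (of_real r)) holomorphic_on ?K" for r
    unfolding scaled_base_def by (intro holomorphic_intros hol) (use slit in auto)
  have hol_profile: "(\<lambda>z. complex_profile (U z) (of_real r)) holomorphic_on ?K" for r
    unfolding complex_profile_def by (intro holomorphic_intros holG) (use slit in auto)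
  have hol_profile': "(\<lambda>z. complex_profile' (U z) (of_real r)) holomorphic_on ?K" for r
    unfolding complex_profile'_def scaled_base'_def by (intro holomorphic_intros hol hol_profile holG) (use slit in auto)
  have contU: "continuous_on (?K \<times> {0..}) (\<lambda>x::complex \<times> real. U (fst x))"
    by (rule continuous_on_compose2[OF holomorphic_on_imp_continuous_on[OF hol]])
       (auto intro!: continuous_intros)
  have contG: "continuous_on (?K \<times> {0..}) (\<lambda>x::complex \<times> real. scaled_base (U (fst x)) (of_real (snd x)))"
    unfolding scaled_base_def by (intro continuous_intros contU) (use slit in auto)
  have cont_profile: "continuous_on (?K \<times> {0..}) (\<lambda>x::complex \<times> real. complex_profile (U (fst x)) (of_real (snd x)))"
    unfolding complex_profile_def by (intro continuous_intros contG) (use slit in auto)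
  have cont_profile': "continuous_on (?K \<times> {0..}) (\<lambda>x::complex \<times> real. complex_profile' (U (fst x)) (of_real (snd x)))"
    unfolding complex_profile'_def scaled_base'_def by (intro continuous_intros contU contG cont_profile) (use slit in auto)
  show "\<exists>r > 0. \<exists>c :: nat \<Rightarrow> real \<Rightarrow> real.
        (\<forall>n. c n \<in> sobolev 1 UNIV) \<and>
        (\<forall>z \<in> ?I. \<bar>z - z\<^sub>0\<bar> < r \<longrightarrow>
           (\<lambda>N. H1_norm (\<lambda>x. profile a b p w z x - (\<Sum>n<N. (z - z\<^sub>0) ^ n * c n x))) \<longlonglongrightarrow> 0)"
  proof (rule H1_power_series_of_holomorphic_family[OF positive(3) \<rho>, where M = "decay_bound \<delta>"
        and \<psi> = "\<lambda>z r. complex_profile (U z) (of_real r)" and \<psi>' = "\<lambda>z r. complex_profile' (U z) (of_real r)"])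
    show "profile a b p w z x = Re (complex_profile (U (of_real z)) (of_real \<bar>x\<bar>))" if "z \<in> ?I" for z x
      by (rule profile_eq_Re_complex_profile[OF small[OF that]])
  qed (use hol_profile hol_profile' cont_profile cont_profile' complex_profile_has_vector_derivative[OF Re_ge \<delta>] complex_profile_decay[OF Re_ge \<delta>]
         in \<open>auto simp: case_prod_beta intro: holomorphic_on_subset[OF _ ball_subset_cball]\<close>)
qed

end

theorem theorem5:
  fixes a b p Z w :: real
  assumes "p > 1"
  shows
    "(a > 0 \<and> b > 0 \<and> Z\<^sup>2 / 4 < - w \<longrightarrow>
        equilibrium a b p w Z (profile a b p w Z) \<and>
        real_analytic_H1_on (\<lambda>z. profile a b p w z) {- 2 * sqrt (- w)<..<2 * sqrt (- w)}) \<and>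
     (a > 0 \<and> b < 0 \<and> Z\<^sup>2 / 4 < - w \<and> - w < - (p * a\<^sup>2 / ((p + 1)\<^sup>2 * b)) \<longrightarrow>
        equilibrium a b p w Z (profile a b p w Z) \<and>
        real_analytic_H1_on (\<lambda>z. profile a b p w z) {- 2 * sqrt (- w)<..<2 * sqrt (- w)})"
proof -
  have main: "equilibrium a b p w Z (profile a b p w Z) \<and>
      real_analytic_H1_on (\<lambda>z. profile a b p w z) {- 2 * sqrt (- w)<..<2 * sqrt (- w)}"
    if "a > 0" "Z\<^sup>2 / 4 < - w" "(a / (p + 1))\<^sup>2 - b / p * w > 0"
  proof -
    have w: "w < 0" using that(2) zero_le_power2[of Z] by linarith
    interpret profile_parameters a b p w
      by unfold_locales (use assms that w in auto)
    \<comment> \<open>The hypothesis on \<open>Z\<close> puts \<open>Z / (2 * k)\<close> into the range of \<open>R\<close>.\<close>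
    have "\<bar>Z\<bar>\<^sup>2 < (2 * k)\<^sup>2" using that(2) by (simp add: power_mult_distrib k_sq)
    then have "\<bar>Z\<bar> < 2 * k" by (rule power2_less_imp_less) (use positive in simp)
    then have "\<bar>Z / (2 * k)\<bar> < 1" using positive by simp
    then show ?thesis using profile_equilibrium profile_analytic by (simp add: k_def)
  qed
  have pos: "(a / (p + 1))\<^sup>2 - b / p * w > 0" if "a > 0" "b > 0" "Z\<^sup>2 / 4 < - w"
  proof -
    have "w < 0" using that(3) zero_le_power2[of Z] by linarith
    then have "b / p * w < 0" using that assms by (intro mult_pos_neg) auto
    then show ?thesis using zero_le_power2[of "a / (p + 1)"] by linarith
  qed
  have neg: "(a / (p + 1))\<^sup>2 - b / p * w > 0"
    if "b < 0" "- w < - (p * a\<^sup>2 / ((p + 1)\<^sup>2 * b))"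
  proof -
    have "b / p < 0" using that assms by (simp add: divide_neg_pos)
    \<comment> \<open>For \<open>b < 0\<close> the upper bound on \<open>- w\<close> is exactly positivity of the discriminant, multiplied
      by the negative number \<open>p / b\<close>.\<close>
    from mult_strict_left_mono_neg[OF that(2) this]
    have "b / p * - (p * a\<^sup>2 / ((p + 1)\<^sup>2 * b)) < b / p * - w" .
    moreover have "b / p * - (p * a\<^sup>2 / ((p + 1)\<^sup>2 * b)) = - (a / (p + 1))\<^sup>2"
      using that assms by (simp add: power_divide)
    ultimately show ?thesis by simp
  qed
  show ?thesis using main pos neg by blast
qed

end
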